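(* Let $\bm\sigma^*$ be the optimal flux defined in the context. A function $\bm\theta^*\in\mathcal T$ is a maximizer of $I$ over $\mathcal T$ if and only if both of the following hold: (i) $\bm\theta^*$ is a solution of the optimization problem $$\text{maximize}\quad H(\bm\theta,\bm\sigma^* )=\sum_{i=1}^m\mu_i\int_\Omega\frac{|\bm\sigma_i^*|^2}{\lambda_-(\bm\theta)}\,d\mathbf x\quad\text{over }\bm\theta\in\mathcal T;$$ (ii) $\bm\sigma_i^*=\lambda_-(\bm\theta^* )\nabla u_i^*$ a.e. in $\Omega$ for $i=1,\dots,m$, where $u_i^*\in H^1_0(\Omega)$ is the solution of $-\mathrm{div}(\lambda_-(\bm\theta^* )\nabla u_i^* )=f_i$.
   Context: Setting. $\Omega\subseteq\mathbb R^d$ is open and bounded, $\mu$ is the $d$-dimensional Lebesgue measure, $N,m\ge1$. $\mathbf M_1,\dots,\mathbf M_N$ are symmetric positive definite $d\times d$ real matrices, and $\lambda_1(\mathbf M)$ denotes the smallest eigenvalue of a symmetric matrix $\mathbf M$. $q_1,\dots,q_N\ge0$ are prescribed amounts with $\sum_{i=1}^Nq_i=\mu(\Omega)$, $f_1,\dots,f_m\in H^{-1}(\Omega)$, and $\mu_1,\dots,\mu_m>0$ are weights. Let $K=\{\bm\theta\in[0,1]^N:\sum_{i=1}^N\theta_i=1\}$, and $\mathcal T=\{\bm\theta\in L^\infty(\Omega;K):\int_\Omega\theta_i\,d\mathbf x=q_i,\ i=1,\dots,N\}$. For $\bm\theta\in K$ let $\lambda_-(\bm\theta)>0$ be defined by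 $\frac1{\lambda_-(\bm\theta)}=\sum_{i=1}^N\frac{\theta_i}{\lambda_1(\mathbf M_i)}$. For $\bm\theta\in\mathcal T$ let $u_i\in H^1_0(\Omega)$ be the unique solution of $-\mathrm{div}(\lambda_-(\bm\theta)\nabla u_i)=f_i$, $i=1,\dots,m$, and put $I(\bm\theta)=\sum_{i=1}^m\mu_i\int_\Omega f_iu_i\,d\mathbf x$ (the integral meaning the $H^{-1}$–$H^1_0$ duality pairing). Let $\mathcal S=\{\bm\sigma=(\bm\sigma_1,\dots,\bm\sigma_m)\in L^2(\Omega;\mathbb R^d)^m:-\mathrm{div}\,\bm\sigma_i=f_i,\ i=1,\dots,m\}$ and $$H(\bm\theta,\bm\sigma)=\sum_{i=1}^m\mu_i\int_\Omega\frac{|\bm\sigma_i|^2}{\lambda_-(\bm\theta)}\,d\mathbf x,\qquad \bm\theta\in\mathcal T,\ \bm\sigma\in\mathcal S.$$ A saddle point of $H$ is a pair $(\bm\theta^*,\bm\sigma^* )\in\mathcal T\times\mathcal S$ with $H(\bm\theta,\bm\sigma^* )\le H(\bm\theta^*,\bm\sigma^* )\le H(\bm\theta^*,\bm\sigma)$ for all $\bm\theta\in\mathcal T,\bm\sigma\in\mathcal S$. By the classical saddle-point theorem, saddle points exist, and their set has the form $\mathcal T^*\times\{\bm\sigma^*\}$ for a unique $\bm\sigma^*\in\mathcal S$, called the optimal flux. *)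

theory Defs
  imports "HOL-Analysis.Analysis"
begin

section \<open>Test functions\<close>

definition partial_deriv :: "'d::finite \<Rightarrow> (real^'d \<Rightarrow> real) \<Rightarrow> real^'d \<Rightarrow> real" where
  "partial_deriv j \<phi> x = frechet_derivative \<phi> (at x) (axis j 1)"

primrec C_k :: "nat \<Rightarrow> (real^'d::finite \<Rightarrow> real) \<Rightarrow> bool" where
  "C_k 0 \<phi> \<longleftrightarrow> continuous_on UNIV \<phi>"
| "C_k (Suc k) \<phi> \<longleftrightarrow> \<phi> differentiable_on UNIV \<and> (\<forall>j. C_k k (partial_deriv j \<phi>))"

definition test_functions :: "(real^'d::finite) set \<Rightarrow> (real^'d \<Rightarrow> real) set" where
  "test_functions \<Omega> =
     {\<phi>. (\<forall>k. C_k k \<phi>) \<and> compact (closure {x. \<phi> x \<noteq> 0}) \<and> closure {x. \<phi> x \<noteq> 0} \<subseteq> \<Omega>}"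


section \<open>Lebesgue and Sobolev spaces\<close>

text \<open>
  Elements of the function spaces are represented by total functions; only their values
  on \<open>\<Omega>\<close>, up to Lebesgue null sets, matter.
\<close>

definition L2 :: "(real^'d::finite) set \<Rightarrow> (real^'d \<Rightarrow> 'b::euclidean_space) set" where
  "L2 \<Omega> = {g. g \<in> borel_measurable (lebesgue_on \<Omega>) \<and>
              integrable (lebesgue_on \<Omega>) (\<lambda>x. (norm (g x))\<^sup>2)}"

definition is_weak_grad ::
    "(real^'d::finite) set \<Rightarrow> (real^'d \<Rightarrow> real) \<Rightarrow> (real^'d \<Rightarrow> real^'d) \<Rightarrow> bool" where
  "is_weak_grad \<Omega> u g \<longleftrightarrow>
     (\<forall>\<phi>\<in>test_functions \<Omega>. \<forall>j.
        (LINT x|lebesgue_on \<Omega>. u x * partial_deriv j \<phi> x)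
          = - (LINT x|lebesgue_on \<Omega>. g x $ j * \<phi> x))"

definition H1 :: "(real^'d::finite) set \<Rightarrow> (real^'d \<Rightarrow> real) set" where
  "H1 \<Omega> = {u \<in> L2 \<Omega>. \<exists>g\<in>L2 \<Omega>. is_weak_grad \<Omega> u g}"

text \<open>For \<open>u \<in> H1 \<Omega>\<close> the choice is determined up to null sets.\<close>

definition wgrad :: "(real^'d::finite) set \<Rightarrow> (real^'d \<Rightarrow> real) \<Rightarrow> real^'d \<Rightarrow> real^'d" where
  "wgrad \<Omega> u = (SOME g. g \<in> L2 \<Omega> \<and> is_weak_grad \<Omega> u g)"

definition H1_norm :: "(real^'d::finite) set \<Rightarrow> (real^'d \<Rightarrow> real) \<Rightarrow> real" where
  "H1_norm \<Omega> u = sqrt ((LINT x|lebesgue_on \<Omega>. (u x)\<^sup>2)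
                       + (LINT x|lebesgue_on \<Omega>. (norm (wgrad \<Omega> u x))\<^sup>2))"

definition H10 :: "(real^'d::finite) set \<Rightarrow> (real^'d \<Rightarrow> real) set" where
  "H10 \<Omega> = {u \<in> H1 \<Omega>. \<exists>\<phi>. (\<forall>n::nat. \<phi> n \<in> test_functions \<Omega>) \<and>
                        (\<lambda>n. H1_norm \<Omega> (\<lambda>x. \<phi> n x - u x)) \<longlonglongrightarrow> 0}"

text \<open>
  The dual space of \<open>H10 \<Omega>\<close>; the application \<open>F v\<close> is the duality pairing. Boundedness
  and linearity force \<open>F\<close> to agree on functions that coincide almost everywhere in \<open>\<Omega>\<close>.
\<close>

definition H_minus1 :: "(real^'d::finite) set \<Rightarrow> ((real^'d \<Rightarrow> real) \<Rightarrow> real) set" where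
  "H_minus1 \<Omega> = {F.
     (\<forall>u\<in>H10 \<Omega>. \<forall>v\<in>H10 \<Omega>. F (\<lambda>x. u x + v x) = F u + F v) \<and>
     (\<forall>c. \<forall>u\<in>H10 \<Omega>. F (\<lambda>x. c * u x) = c * F u) \<and>
     (\<exists>C. \<forall>u\<in>H10 \<Omega>. \<bar>F u\<bar> \<le> C * H1_norm \<Omega> u)}"

text \<open>The equation \<open>- div \<sigma> = F\<close> between elements of the dual of \<open>H10 \<Omega>\<close>.\<close>

definition neg_div_eq ::
    "(real^'d::finite) set \<Rightarrow> (real^'d \<Rightarrow> real^'d) \<Rightarrow> ((real^'d \<Rightarrow> real) \<Rightarrow> real) \<Rightarrow> bool" where
  "neg_div_eq \<Omega> \<sigma> F \<longleftrightarrow>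
     (\<forall>v\<in>H10 \<Omega>. (LINT x|lebesgue_on \<Omega>. \<sigma> x \<bullet> wgrad \<Omega> v x) = F v)"


section \<open>Materials\<close>

definition sym_pos_def :: "real^'d^'d::finite \<Rightarrow> bool" where
  "sym_pos_def A \<longleftrightarrow> transpose A = A \<and> (\<forall>v. v \<noteq> 0 \<longrightarrow> 0 < v \<bullet> (A *v v))"

definition is_eigenvalue :: "real^'d^'d::finite \<Rightarrow> real \<Rightarrow> bool" where
  "is_eigenvalue A l \<longleftrightarrow> (\<exists>v. v \<noteq> 0 \<and> A *v v = l *\<^sub>R v)"

definition lambda1 :: "real^'d^'d::finite \<Rightarrow> real" where
  "lambda1 A = (LEAST l. is_eigenvalue A l)"

definition K :: "(real^'n::finite) set" where
  "K = {t. (\<forall>k. t $ k \<in> {0..1}) \<and> (\<Sum>k\<in>UNIV. t $ k) = 1}"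

definition lambda_minus :: "('n::finite \<Rightarrow> real^'d^'d::finite) \<Rightarrow> real^'n \<Rightarrow> real" where
  "lambda_minus M t = 1 / (\<Sum>k\<in>UNIV. t $ k / lambda1 (M k))"

text \<open>Essential boundedness is automatic because \<open>K\<close> is bounded.\<close>

definition admissible ::
    "(real^'d::finite) set \<Rightarrow> ('n::finite \<Rightarrow> real) \<Rightarrow> (real^'d \<Rightarrow> real^'n) set" where
  "admissible \<Omega> q = {\<theta>. \<theta> \<in> borel_measurable (lebesgue_on \<Omega>) \<and>
     (AE x in lebesgue_on \<Omega>. \<theta> x \<in> K) \<and>
     (\<forall>k. (LINT x|lebesgue_on \<Omega>. \<theta> x $ k) = q k)}"


section \<open>State equations and the objective\<close>

definition weak_solution ::
    "(real^'d::finite) set \<Rightarrow> (real^'d \<Rightarrow> real) \<Rightarrow> ((real^'d \<Rightarrow> real) \<Rightarrow> real) \<Rightarrow>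
     (real^'d \<Rightarrow> real) \<Rightarrow> bool" where
  "weak_solution \<Omega> a F u \<longleftrightarrow> u \<in> H10 \<Omega> \<and> neg_div_eq \<Omega> (\<lambda>x. a x *\<^sub>R wgrad \<Omega> u x) F"

text \<open>The solution is unique up to null sets, hence the choice of a representative.\<close>

definition state ::
    "(real^'d::finite) set \<Rightarrow> ('n::finite \<Rightarrow> real^'d^'d) \<Rightarrow> ((real^'d \<Rightarrow> real) \<Rightarrow> real) \<Rightarrow>
     (real^'d \<Rightarrow> real^'n) \<Rightarrow> real^'d \<Rightarrow> real" where
  "state \<Omega> M F \<theta> = (SOME u. weak_solution \<Omega> (\<lambda>x. lambda_minus M (\<theta> x)) F u)"

definition I_fun ::
    "(real^'d::finite) set \<Rightarrow> ('n::finite \<Rightarrow> real^'d^'d) \<Rightarrow> ('m::finite \<Rightarrow> (real^'d \<Rightarrow> real) \<Rightarrow> real) \<Rightarrow>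
     ('m \<Rightarrow> real) \<Rightarrow> (real^'d \<Rightarrow> real^'n) \<Rightarrow> real" where
  "I_fun \<Omega> M f \<mu> \<theta> = (\<Sum>i\<in>UNIV. \<mu> i * f i (state \<Omega> M (f i) \<theta>))"


section \<open>Fluxes and saddle points\<close>

definition fluxes ::
    "(real^'d::finite) set \<Rightarrow> ('m::finite \<Rightarrow> (real^'d \<Rightarrow> real) \<Rightarrow> real) \<Rightarrow>
     ('m \<Rightarrow> real^'d \<Rightarrow> real^'d) set" where
  "fluxes \<Omega> f = {\<sigma>. \<forall>i. \<sigma> i \<in> L2 \<Omega> \<and> neg_div_eq \<Omega> (\<sigma> i) (f i)}"

definition H_fun ::
    "(real^'d::finite) set \<Rightarrow> ('n::finite \<Rightarrow> real^'d^'d) \<Rightarrow> ('m::finite \<Rightarrow> real) \<Rightarrow>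
     (real^'d \<Rightarrow> real^'n) \<Rightarrow> ('m \<Rightarrow> real^'d \<Rightarrow> real^'d) \<Rightarrow> real" where
  "H_fun \<Omega> M \<mu> \<theta> \<sigma> =
     (\<Sum>i\<in>UNIV. \<mu> i * (LINT x|lebesgue_on \<Omega>. (norm (\<sigma> i x))\<^sup>2 / lambda_minus M (\<theta> x)))"

definition saddle_point ::
    "(real^'d::finite) set \<Rightarrow> ('n::finite \<Rightarrow> real^'d^'d) \<Rightarrow> ('n \<Rightarrow> real) \<Rightarrow>
     ('m::finite \<Rightarrow> (real^'d \<Rightarrow> real) \<Rightarrow> real) \<Rightarrow> ('m \<Rightarrow> real) \<Rightarrow>
     (real^'d \<Rightarrow> real^'n) \<Rightarrow> ('m \<Rightarrow> real^'d \<Rightarrow> real^'d) \<Rightarrow> bool" where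
  "saddle_point \<Omega> M q f \<mu> \<theta>' \<sigma>' \<longleftrightarrow>
     \<theta>' \<in> admissible \<Omega> q \<and> \<sigma>' \<in> fluxes \<Omega> f \<and>
     (\<forall>\<theta>\<in>admissible \<Omega> q. H_fun \<Omega> M \<mu> \<theta> \<sigma>' \<le> H_fun \<Omega> M \<mu> \<theta>' \<sigma>') \<and>
     (\<forall>\<sigma>\<in>fluxes \<Omega> f. H_fun \<Omega> M \<mu> \<theta>' \<sigma>' \<le> H_fun \<Omega> M \<mu> \<theta>' \<sigma>)"

text \<open>
  The flux component of a saddle point. That all saddle points share this component (up to
  null sets) is a consequence of strict convexity and is not built into the definition.
\<close>

definition optimal_flux ::
    "(real^'d::finite) set \<Rightarrow> ('n::finite \<Rightarrow> real^'d^'d) \<Rightarrow> ('n \<Rightarrow> real) \<Rightarrow>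
     ('m::finite \<Rightarrow> (real^'d \<Rightarrow> real) \<Rightarrow> real) \<Rightarrow> ('m \<Rightarrow> real) \<Rightarrow>
     ('m \<Rightarrow> real^'d \<Rightarrow> real^'d) \<Rightarrow> bool" where
  "optimal_flux \<Omega> M q f \<mu> \<sigma> \<longleftrightarrow> (\<exists>\<theta>. saddle_point \<Omega> M q f \<mu> \<theta> \<sigma>)"

end

(*
  For a fixed design, the state fluxes minimise H over all admissible fluxes; expanding the square
  around them, and testing both flux equations with the state, gives

    H(theta, sigma) = I(theta) + sum_i mu_i int |sigma_i - lambda_minus(theta) grad u_i|^2 / lambda_minus(theta).

  Hence I(theta) <= H(theta, sigma), with equality iff sigma is the family of state fluxes of theta.
  At a saddle point (theta0, sigma') this yields I(theta0) = H(theta0, sigma') = max_t H(t, sigma'),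
  so theta maximises I iff I(theta) = H(theta, sigma') = max_t H(t, sigma').

  The identity presupposes that the state equations are solvable: weak gradients are unique by the
  fundamental lemma of the calculus of variations, and a minimising sequence of test functions for the
  energy converges by the Poincare inequality and the completeness of L2.
*)

theory Submission
  imports Defs
begin

section \<open>Smooth bump functions\<close>

text \<open>\<open>wgrad\<close> and \<open>state\<close> are Hilbert choices, determined only up to
  null sets, so \<open>wgrad\<close> is linear only almost everywhere. This shapes the existence
  argument: the energy form lives on test functions, where the classical gradient
  \<open>grad\<close> is linear at every point, and \<open>wgrad\<close> enters only after the
  passage to the limit. Membership in \<open>H10\<close> is recast to match, as joint L2 convergence
  of test functions and of their gradients. The fundamental lemma needs concrete test functions.
  Since \<open>C_k\<close> is a recursion through partial derivatives, smoothness of exp(-1/t) is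
  proved for a whole family of functions closed under differentiation. In the energy identity the
  weight 1 / \<open>lambda_minus\<close> cancels the coefficient in the state flux. The cross term
  of the square thus becomes the pairing of a flux with the gradient of the state, whose value is
  the load applied to the state, the same for every admissible flux.\<close>

lemma partial_deriv_has_derivative:
  assumes "(f has_derivative f') (at x)"
  shows "partial_deriv j f x = f' (axis j 1)"
  using frechet_derivative_at[OF assms] by (simp add: partial_deriv_def)

section \<open>Algebra of \<open>C_k\<close> functions\<close>

lemma C_k_imp_continuous: "C_k k f \<Longrightarrow> continuous_on UNIV f"
  by (cases k) (auto intro: differentiable_imp_continuous_on)

text \<open>The product rule leaves one factor undifferentiated; induction on the order has to lower
  the regularity of that factor.\<close>

lemma C_k_SucD: "C_k (Suc k) f \<Longrightarrow> C_k k f"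
proof (induction k arbitrary: f)
  case 0
  then show ?case by (auto intro: differentiable_imp_continuous_on)
next
  case (Suc k)
  then show ?case by (metis C_k.simps(2))
qed

lemma C_k_Suc_differentiable: "C_k (Suc k) f \<Longrightarrow> f differentiable (at x)"
  by (auto simp: differentiable_on_def)

lemma C_k_const: "C_k k (\<lambda>x. c)"
proof (induction k arbitrary: c)
  case (Suc k)
  have "partial_deriv j (\<lambda>x. c) = (\<lambda>x. 0)" for j :: 'a
    by (rule ext) (simp add: partial_deriv_def)
  then show ?case using Suc by simp
qed simp

lemma C_k_add: "C_k k f \<Longrightarrow> C_k k g \<Longrightarrow> C_k k (\<lambda>x. f x + g x)"
proof (induction k arbitrary: f g)
  case (Suc k)
  have "partial_deriv j (\<lambda>x. f x + g x) = (\<lambda>x. partial_deriv j f x + partial_deriv j g x)" for j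
    using Suc.prems[THEN C_k_Suc_differentiable]
    unfolding frechet_derivative_works
    by (intro ext, subst partial_deriv_has_derivative[OF has_derivative_add])
       (auto simp: partial_deriv_def)
  then show ?case using Suc by (auto intro: differentiable_on_add)
qed (auto intro: continuous_on_add)

lemma partial_deriv_mult:
  assumes "f differentiable (at x)" "g differentiable (at x)"
  shows "partial_deriv j (\<lambda>x. f x * g x) x = f x * partial_deriv j g x + partial_deriv j f x * g x"
  using partial_deriv_has_derivative[OF has_derivative_mult[OF
      assms[unfolded frechet_derivative_works]]]
  by (simp add: partial_deriv_def)

lemma C_k_mult: "C_k k f \<Longrightarrow> C_k k g \<Longrightarrow> C_k k (\<lambda>x. f x * g x)"
proof (induction k arbitrary: f g)
  case (Suc k)
  have eq: "partial_deriv j (\<lambda>x. f x * g x) =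
      (\<lambda>x. f x * partial_deriv j g x + partial_deriv j f x * g x)" for j
    using Suc.prems[THEN C_k_Suc_differentiable] by (intro ext) (simp add: partial_deriv_mult)
  have "C_k k (\<lambda>x. f x * partial_deriv j g x + partial_deriv j f x * g x)" for j
    using Suc.prems Suc.prems[THEN C_k_SucD] by (intro C_k_add Suc.IH) auto
  then show ?case using Suc.prems unfolding C_k.simps eq by (auto intro: differentiable_on_mult)
qed (auto intro: continuous_on_mult)

lemma C_k_prod: "(\<And>i. i \<in> A \<Longrightarrow> C_k k (f i)) \<Longrightarrow> C_k k (\<lambda>x. \<Prod>i\<in>A. f i x)"
  by (induction A rule: infinite_finite_induct) (auto intro: C_k_const C_k_mult)

text \<open>The index map \<open>D\<close> stands for differentiation inside the family
  \<open>F\<close>. By the chain rule each partial derivative is a constant times another member of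
  the family, so induction with arbitrary \<open>p\<close> reaches every order without computing
  higher derivatives.\<close>

lemma C_k_affine_compose:
  assumes deriv: "\<And>p t. ((F p) has_real_derivative F (D p) t) (at t)"
  shows "C_k k (\<lambda>x. F p (c * x $ i + d))"
proof (induction k arbitrary: p)
  case 0
  have "continuous_on UNIV (F p)"
    using deriv DERIV_continuous_on by (metis has_field_derivative_at_within)
  then show ?case
    by (auto intro!: continuous_intros continuous_on_compose2[of UNIV "F p"])
next
  case (Suc k)
  have der: "((\<lambda>x::real^'d::finite. F p (c * x $ i + d)) has_derivative
      (\<lambda>h. F (D p) (c * x $ i + d) * (c * h $ i))) (at x)" for x i
    by (rule has_derivative_eq_rhs, rule has_derivative_compose[OF _ deriv[unfolded has_field_derivative_def]])
       (auto intro!: derivative_eq_intros bounded_linear_imp_has_derivative bounded_linear_vec_nth)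
  have "partial_deriv j (\<lambda>x. F p (c * x $ i + d)) =
      (\<lambda>x. (c * axis j 1 $ i) * F (D p) (c * x $ i + d))" for j
    by (intro ext) (simp add: partial_deriv_has_derivative[OF der])
  moreover have "(\<lambda>x::real^'b. F p (c * x $ i + d)) differentiable_on UNIV"
    using der by (force simp: differentiable_on_def differentiable_def)
  ultimately show ?case using Suc.IH by (auto intro: C_k_mult C_k_const)
qed

lemma C_k_component: "C_k k (\<lambda>x. x $ i)"
proof -
  \<comment> \<open>The successive derivatives of the identity: t, 1, 0, 0, and so on, with
    \<open>Suc\<close> as the derivative map.\<close>
  define F :: "nat \<Rightarrow> real \<Rightarrow> real"
    where "F = (\<lambda>p t. if p = 0 then t else if p = 1 then 1 else 0)"
  have "((F p) has_real_derivative F (Suc p) t) (at t)" for p t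
    by (auto simp: F_def)
  from C_k_affine_compose[of F Suc, OF this, of k 0 1 i 0] show ?thesis
    by (simp add: F_def)
qed

text \<open>The polynomial parameter closes the family under differentiation: derivatives of
  exp(-1/t) only ever acquire polynomial factors in 1/t. The classical smooth non-analytic function
  is \<open>flat 1\<close>.\<close>

definition flat :: "real poly \<Rightarrow> real \<Rightarrow> real" where
  "flat p t = (if t > 0 then poly p (1 / t) * exp (- (1 / t)) else 0)"

text \<open>Substituting s = 1/t moves the limit to infinity, where exp(s) dominates each monomial
  of \<open>p\<close>.\<close>

lemma flat_tendsto_0:
  fixes p :: "real poly"
  shows "((\<lambda>t. poly p (1 / t) * exp (- (1 / t))) \<longlongrightarrow> 0) (at_right 0)"
proof -
  have "((\<lambda>s::real. \<Sum>i\<le>degree p. coeff p i * (s ^ i / exp s)) \<longlongrightarrow> (\<Sum>i\<le>degree p. coeff p i * 0)) at_top"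
    by (intro tendsto_intros tendsto_power_div_exp_0)
  moreover have "(\<lambda>s. \<Sum>i\<le>degree p. coeff p i * (s ^ i / exp s)) = (\<lambda>s. poly p s * exp (- s))"
    by (simp add: poly_altdef exp_minus field_simps sum_distrib_left sum_distrib_right fun_eq_iff sum_divide_distrib)
  ultimately have "((\<lambda>s. poly p s * exp (- s)) \<longlongrightarrow> 0) at_top"
    by simp
  then have "((\<lambda>t. poly p (inverse t) * exp (- (inverse t))) \<longlongrightarrow> 0) (at_right 0)"
    by (rule filterlim_compose[OF _ filterlim_inverse_at_top_right])
  then show ?thesis by (simp add: field_simps)
qed

text \<open>With s = 1/t, the derivative of p(s) exp(-s) in t is s^2 (p(s) - p'(s)) exp(-s);
  \<open>[:0, 0, 1:]\<close> is the factor s^2 from the inner derivative.\<close>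

definition flat_deriv :: "real poly \<Rightarrow> real poly" where
  "flat_deriv p = [:0, 0, 1:] * (p - pderiv p)"

lemma has_field_derivative_flat: "(flat p has_real_derivative flat (flat_deriv p) t) (at t)"
proof (cases t "0::real" rule: linorder_cases)
  case less
  have "((\<lambda>_. 0) has_real_derivative 0) (at t)" by simp
  then have "(flat p has_real_derivative 0) (at t)"
    by (rule has_field_derivative_transform_within_open[where S="{..<0}"]) (use less in \<open>auto simp: flat_def\<close>)
  then show ?thesis using less by (simp add: flat_def)
next
  case greater
  have "((\<lambda>t. poly p (1 / t) * exp (- (1 / t))) has_real_derivative flat (flat_deriv p) t) (at t)"
    using greater
    by (auto intro!: derivative_eq_intros DERIV_chain2[OF poly_DERIV]
        simp: flat_def flat_deriv_def field_simps power2_eq_square)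
  then show ?thesis
    by (rule has_field_derivative_transform_within_open[where S="{0<..}"]) (use greater in \<open>auto simp: flat_def\<close>)
next
  case equal
  \<comment> \<open>Dividing by h multiplies the polynomial in 1/h by its variable, so the
    right-hand difference quotient is again of the form covered by
    \<open>flat_tendsto_0\<close>.\<close>
  have "((\<lambda>h. flat p h / h) \<longlongrightarrow> 0) (at_right 0)"
    using flat_tendsto_0[of "[:0, 1:] * p"]
    by (rule Lim_transform_eventually) (auto simp: eventually_at_filter flat_def)
  moreover have "((\<lambda>h. flat p h / h) \<longlongrightarrow> 0) (at_left 0)"
    by (rule Lim_transform_eventually[OF tendsto_const]) (auto simp: eventually_at_filter flat_def)
  ultimately have "((\<lambda>h. flat p h / h) \<longlongrightarrow> 0) (at 0)"
    by (simp add: filterlim_split_at)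
  then show ?thesis using equal by (simp add: has_field_derivative_iff flat_def)
qed

text \<open>Each factor is positive exactly on one side of a face of the box. The scale
  \<open>Suc n\<close> drives its argument to infinity, where \<open>flat 1\<close> tends to 1, so
  the bumps tend to the indicator of the open box while staying between 0 and 1, as dominated
  convergence requires.\<close>

definition bump :: "nat \<Rightarrow> real^'d \<Rightarrow> real^'d \<Rightarrow> real^'d::finite \<Rightarrow> real" where
  "bump n a b x = (\<Prod>i\<in>UNIV. flat 1 (real (Suc n) * (x $ i - a $ i)) * flat 1 (real (Suc n) * (b $ i - x $ i)))"

lemma C_k_bump: "C_k k (bump n a b)"
proof -
  have "C_k k (\<lambda>x::real^'a. flat 1 (c * x $ i + d))" for c d i
    by (rule C_k_affine_compose[of flat flat_deriv, OF has_field_derivative_flat])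
  from this[of "real (Suc n)" _ "- real (Suc n) * a $ _"] this[of "- real (Suc n)" _ "real (Suc n) * b $ _"]
  have "C_k k (\<lambda>x. flat 1 (real (Suc n) * (x $ i - a $ i)))"
       "C_k k (\<lambda>x. flat 1 (real (Suc n) * (b $ i - x $ i)))" for i
    by (simp_all add: algebra_simps)
  then show ?thesis unfolding bump_def[abs_def] by (intro C_k_prod C_k_mult)
qed

lemma flat_1_bounds: "0 \<le> flat 1 t" "flat 1 t \<le> 1"
  by (auto simp: flat_def)

lemma bump_bounds: "0 \<le> bump n a b x" "bump n a b x \<le> 1"
  unfolding bump_def
  by (auto intro!: prod_nonneg prod_le_1 mult_nonneg_nonneg mult_le_one flat_1_bounds)

lemma bump_outside: "x \<notin> box a b \<Longrightarrow> bump n a b x = 0"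
  by (force simp: bump_def mem_box_cart flat_def zero_less_mult_iff)

lemma bump_tendsto_indicator: "(\<lambda>n. bump n a b x) \<longlonglongrightarrow> indicat_real (box a b) x"
proof (cases "x \<in> box a b")
  case True
  have *: "(\<lambda>n. flat 1 (real (Suc n) * t)) \<longlonglongrightarrow> 1" if "t > 0" for t
  proof -
    have "(\<lambda>n. inverse (real (Suc n)) * (1 / t)) \<longlonglongrightarrow> 0 * (1 / t)"
      by (intro tendsto_mult LIMSEQ_inverse_real_of_nat tendsto_const)
    then have "(\<lambda>n. exp (- (inverse (real (Suc n)) * (1 / t)))) \<longlonglongrightarrow> exp (- 0)"
      by (intro tendsto_intros) simp
    moreover have "flat 1 (real (Suc n) * t) = exp (- (inverse (real (Suc n)) * (1 / t)))" for n
      using that by (simp add: flat_def zero_less_mult_iff field_simps add_pos_nonneg)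
    ultimately show ?thesis by simp
  qed
  have "(\<lambda>n. bump n a b x) \<longlonglongrightarrow> (\<Prod>i\<in>(UNIV::'a set). 1 * 1)"
    unfolding bump_def using True
    by (intro tendsto_prod tendsto_mult *) (auto simp: mem_box_cart)
  then show ?thesis using True by simp
qed (simp add: bump_outside)

lemma bump_test_function:
  assumes "cbox a b \<subseteq> \<Omega>"
  shows "bump n a b \<in> test_functions \<Omega>"
proof -
  have "{x. bump n a b x \<noteq> 0} \<subseteq> cbox a b"
    using bump_outside box_subset_cbox by blast
  then have "closure {x. bump n a b x \<noteq> 0} \<subseteq> cbox a b"
    by (simp add: closure_minimal closed_cbox)
  then show ?thesis using assms
    by (auto simp: test_functions_def C_k_bump compact_eq_bounded_closed
        intro: bounded_subset[OF bounded_cbox])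
qed

section \<open>Integration by parts for test functions\<close>

lemma integral_lborel_translate:
  fixes f :: "'a::euclidean_space \<Rightarrow> real"
  assumes "f \<in> borel_measurable borel"
  shows "(LINT x|lborel. f (c + x)) = (LINT x|lborel. f x)"
proof -
  have "(LINT x|lborel. f x) = (LINT x|distr lborel borel ((+) c). f x)"
    by (simp add: lborel_distr_plus)
  also have "\<dots> = (LINT x|lborel. f (c + x))"
    using assms by (intro integral_distr) auto
  finally show ?thesis by simp
qed

lemma integrable_lborel_compact_support:
  fixes f :: "'a::euclidean_space \<Rightarrow> 'b::euclidean_space"
  assumes "continuous_on UNIV f" "compact C" "\<And>x. x \<notin> C \<Longrightarrow> f x = 0"
  shows "integrable lborel f"
proof -
  have "integrable lborel (\<lambda>x. indicator C x *\<^sub>R f x)"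
    using assms(2) continuous_on_subset[OF assms(1)] by (intro borel_integrable_compact) auto
  also have "(\<lambda>x. indicator C x *\<^sub>R f x) = f"
    using assms(3) by (auto simp: indicator_def fun_eq_iff)
  finally show ?thesis .
qed

lemma partial_deriv_outside_support:
  assumes "closed C" "\<And>y. y \<notin> C \<Longrightarrow> f y = 0" "x \<notin> C"
  shows "partial_deriv j f x = 0"
proof -
  have "((\<lambda>_. 0) has_derivative (\<lambda>_. 0)) (at x)" by simp
  then have "(f has_derivative (\<lambda>_. 0)) (at x)"
    by (rule has_derivative_transform_within_open[where s = "- C"])
       (use assms in \<open>auto simp: open_Compl\<close>)
  then show ?thesis by (rule partial_deriv_has_derivative)
qed

lemma has_real_derivative_along_axis:
  assumes "C_k (Suc k) f"
  shows "((\<lambda>t. f (t *\<^sub>R axis j 1 + x)) has_real_derivative partial_deriv j f (t *\<^sub>R axis j 1 + x)) (at t)"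
proof -
  let ?y = "t *\<^sub>R axis j 1 + x"
  have f: "(f has_derivative frechet_derivative f (at ?y)) (at ?y)"
    using C_k_Suc_differentiable[OF assms] by (simp add: frechet_derivative_works)
  have "((\<lambda>t. f (t *\<^sub>R axis j 1 + x)) has_derivative
      (\<lambda>h. frechet_derivative f (at ?y) (h *\<^sub>R axis j 1))) (at t)"
    by (rule has_derivative_compose[of "\<lambda>t. t *\<^sub>R axis j 1 + x", OF _ f]) (auto intro!: derivative_eq_intros)
  moreover have "frechet_derivative f (at ?y) (h *\<^sub>R axis j 1) = h * partial_deriv j f ?y" for h
    using linear_scale[OF has_derivative_linear[OF f]] by (simp add: partial_deriv_def)
  ultimately show ?thesis
    by (simp add: has_field_derivative_def mult_commute_abs)
qed

text \<open>
  The integral of a difference quotient vanishes by translation invariance; pass to the limit.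
\<close>

lemma integral_partial_deriv_eq_0:
  assumes f: "C_k (Suc 0) f" and C: "compact C" "\<And>x. x \<notin> C \<Longrightarrow> f x = 0"
  shows "(LINT x|lborel. partial_deriv j f x) = 0"
proof -
  let ?D = "partial_deriv j f" and ?e = "axis j (1::real)"
  define h where "h n = inverse (real (Suc n))" for n
  have h: "0 < h n" "h n \<le> 1" for n
    by (auto simp: h_def field_simps)
  have cf: "continuous_on UNIV f" using f by (rule C_k_imp_continuous)
  have cD: "continuous_on UNIV ?D" using f by simp
  have fm[measurable]: "f \<in> borel_measurable borel"
    using cf by (rule borel_measurable_continuous_onI)
  have Dm[measurable]: "?D \<in> borel_measurable borel"
    using cD by (rule borel_measurable_continuous_onI)
  have intf: "integrable lborel f"
    using cf C by (rule integrable_lborel_compact_support)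
  have intf': "integrable lborel (\<lambda>x. f (c *\<^sub>R ?e + x))" for c
  proof (rule integrable_lborel_compact_support)
    show "continuous_on UNIV (\<lambda>x. f (c *\<^sub>R ?e + x))"
      by (rule continuous_on_compose2[OF cf]) (auto intro!: continuous_intros)
    show "compact ((+) (- c *\<^sub>R ?e) ` C)" using C(1) by (rule compact_translation)
    show "f (c *\<^sub>R ?e + x) = 0" if "x \<notin> (+) (- c *\<^sub>R ?e) ` C" for x
    proof (rule C(2))
      show "c *\<^sub>R ?e + x \<notin> C"
      proof
        assume "c *\<^sub>R ?e + x \<in> C"
        then have "- c *\<^sub>R ?e + (c *\<^sub>R ?e + x) \<in> (+) (- c *\<^sub>R ?e) ` C" by (rule imageI)
        with that show False by simp
      qed
    qed
  qed
  have D0: "?D x = 0" if "x \<notin> C" for x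
    using partial_deriv_outside_support[OF compact_imp_closed[OF C(1)] C(2) that] .
  have "compact (?D ` C)"
    using C(1) cD by (intro compact_continuous_image) (auto intro: continuous_on_subset[OF cD])
  then obtain B where B0: "\<And>x. x \<in> C \<Longrightarrow> \<bar>?D x\<bar> \<le> B"
    using compact_imp_bounded by (force simp: bounded_iff)
  have B: "\<bar>?D x\<bar> \<le> \<bar>B\<bar>" for x
    using B0[of x] D0[of x] by (cases "x \<in> C") auto
  obtain R where R: "\<And>x. x \<in> C \<Longrightarrow> norm x \<le> R"
    using compact_imp_bounded[OF C(1)] by (auto simp: bounded_iff)
  define q where "q n x = (f (h n *\<^sub>R ?e + x) - f x) / h n" for n x
  \<comment> \<open>Writing the quotient as a derivative at an intermediate point yields both a
    bound uniform in \<open>n\<close> and control of the support.\<close>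
  have mvt: "\<exists>z. 0 < z \<and> z < h n \<and> q n x = ?D (z *\<^sub>R ?e + x)" for n x
  proof -
    obtain z where "0 < z" "z < h n"
      "f (h n *\<^sub>R ?e + x) - f (0 *\<^sub>R ?e + x) = (h n - 0) * ?D (z *\<^sub>R ?e + x)"
      using MVT2[of 0 "h n" "\<lambda>t. f (t *\<^sub>R ?e + x)" "\<lambda>t. ?D (t *\<^sub>R ?e + x)"] h(1)[of n]
        has_real_derivative_along_axis[OF f] by blast
    then show ?thesis using h(1)[of n] by (auto simp: q_def)
  qed
  have q0: "(LINT x|lborel. q n x) = 0" for n
    using intf intf'[of "h n"] integral_lborel_translate[OF fm, of "h n *\<^sub>R ?e"]
    by (simp add: q_def)
  \<comment> \<open>Radius \<open>R + 1\<close>: the intermediate point lies within distance 1 of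
    \<open>x\<close> because \<open>h n\<close> is at most 1, so it misses \<open>C\<close> once
    \<open>x\<close> is outside this ball.\<close>
  have bound: "norm (q n x) \<le> indicator (cball 0 (R + 1)) x *\<^sub>R \<bar>B\<bar>" for n x
  proof -
    obtain z where z: "0 < z" "z < h n" "q n x = ?D (z *\<^sub>R ?e + x)" using mvt by blast
    show ?thesis
    proof (cases "norm x \<le> R + 1")
      case True
      then show ?thesis using B z by auto
    next
      case False
      have "norm x \<le> norm (z *\<^sub>R ?e + x) + norm (z *\<^sub>R ?e)"
        by (metis add.commute add_diff_cancel_left' norm_triangle_ineq4)
      moreover have "norm (z *\<^sub>R ?e) \<le> 1" using z h(2)[of n] by (simp add: norm_axis_1)
      ultimately have "z *\<^sub>R ?e + x \<notin> C" using R[of "z *\<^sub>R ?e + x"] False by linarith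
      then show ?thesis using z D0 by simp
    qed
  qed
  have lim: "(\<lambda>n. q n x) \<longlonglongrightarrow> ?D x" for x
  proof -
    have "((\<lambda>t. (f (t *\<^sub>R ?e + x) - f x) / t) \<longlongrightarrow> ?D x) (at 0)"
      using has_real_derivative_along_axis[OF f, of j x 0] by (simp add: has_field_derivative_iff)
    moreover have "filterlim h (at 0) sequentially"
      unfolding filterlim_at h_def using LIMSEQ_inverse_real_of_nat by auto
    ultimately show ?thesis unfolding q_def by (rule filterlim_compose)
  qed
  have "(\<lambda>n. LINT x|lborel. q n x) \<longlonglongrightarrow> (LINT x|lborel. ?D x)"
  proof (rule integral_dominated_convergence)
    show "integrable lborel (\<lambda>x. indicator (cball 0 (R + 1)) x *\<^sub>R \<bar>B\<bar> :: real)"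
      by (rule borel_integrable_compact) auto
    show "q n \<in> borel_measurable lborel" for n unfolding q_def by measurable
  qed (use bound lim in auto)
  then show ?thesis unfolding q0 by (simp add: LIMSEQ_const_iff)
qed

lemma test_functionsE:
  assumes "\<phi> \<in> test_functions \<Omega>"
  shows "\<exists>C. (\<forall>k. C_k k \<phi>) \<and> compact C \<and> C \<subseteq> \<Omega> \<and> (\<forall>x. x \<notin> C \<longrightarrow> \<phi> x = 0)"
  using assms closure_subset[of "{x. \<phi> x \<noteq> 0}"] unfolding test_functions_def by blast

text \<open>Any compact subset of the domain off which the function vanishes can stand in for the
  closed support; sums then need only a union of two such sets.\<close>

lemma test_functionsI:
  assumes "\<And>k. C_k k \<phi>" "compact C" "C \<subseteq> \<Omega>" "\<And>x. x \<notin> C \<Longrightarrow> \<phi> x = 0"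
  shows "\<phi> \<in> test_functions \<Omega>"
proof -
  have "closure {x. \<phi> x \<noteq> 0} \<subseteq> C"
    using assms by (intro closure_minimal compact_imp_closed) auto
  then show ?thesis using assms
    by (auto simp: test_functions_def compact_eq_bounded_closed intro: bounded_subset)
qed

lemma test_functions_add:
  assumes "\<phi> \<in> test_functions \<Omega>" "\<psi> \<in> test_functions \<Omega>"
  shows "(\<lambda>x. \<phi> x + \<psi> x) \<in> test_functions \<Omega>"
proof -
  obtain C where C: "\<forall>k. C_k k \<phi>" "compact C" "C \<subseteq> \<Omega>" "\<forall>x. x \<notin> C \<longrightarrow> \<phi> x = 0"
    using test_functionsE[OF assms(1)] by blast
  obtain D where D: "\<forall>k. C_k k \<psi>" "compact D" "D \<subseteq> \<Omega>" "\<forall>x. x \<notin> D \<longrightarrow> \<psi> x = 0"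
    using test_functionsE[OF assms(2)] by blast
  show ?thesis
    by (rule test_functionsI[of _ "C \<union> D"]) (use C D in \<open>auto intro: C_k_add\<close>)
qed

lemma test_functions_mult:
  assumes "\<And>k. C_k k f" "\<phi> \<in> test_functions \<Omega>"
  shows "(\<lambda>x. f x * \<phi> x) \<in> test_functions \<Omega>"
proof -
  obtain C where C: "\<forall>k. C_k k \<phi>" "compact C" "C \<subseteq> \<Omega>" "\<forall>x. x \<notin> C \<longrightarrow> \<phi> x = 0"
    using test_functionsE[OF assms(2)] by blast
  show ?thesis
    by (rule test_functionsI[of _ C]) (use C assms(1) in \<open>auto intro: C_k_mult\<close>)
qed

lemma test_functions_scale: "\<phi> \<in> test_functions \<Omega> \<Longrightarrow> (\<lambda>x. c * \<phi> x) \<in> test_functions \<Omega>"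
  by (rule test_functions_mult[OF C_k_const])

lemma test_function_partial_deriv:
  assumes "\<phi> \<in> test_functions \<Omega>"
  shows "partial_deriv j \<phi> \<in> test_functions \<Omega>"
proof -
  obtain C where C: "\<forall>k. C_k k \<phi>" "compact C" "C \<subseteq> \<Omega>" "\<forall>x. x \<notin> C \<longrightarrow> \<phi> x = 0"
    using test_functionsE[OF assms(1)] by blast
  show ?thesis
  proof (rule test_functionsI[of _ C])
    show "C_k k (partial_deriv j \<phi>)" for k using C(1)[rule_format, of "Suc k"] by simp
  qed (use C in \<open>auto intro!: partial_deriv_outside_support[of C] compact_imp_closed\<close>)
qed

text \<open>A function supported inside the domain is its own extension by zero. This links
  \<open>lebesgue_on\<close> to \<open>lborel\<close>, where translation invariance is
  exploited.\<close>

lemma lebesgue_on_compact_support: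
  fixes f :: "'a::euclidean_space \<Rightarrow> 'b::euclidean_space"
  assumes "open \<Omega>" "continuous_on UNIV f" "compact C" "C \<subseteq> \<Omega>" "\<And>x. x \<notin> C \<Longrightarrow> f x = 0"
  shows "integrable (lebesgue_on \<Omega>) f" "(LINT x|lebesgue_on \<Omega>. f x) = (LINT x|lborel. f x)"
proof -
  have eq: "(\<lambda>x. indicator \<Omega> x *\<^sub>R f x) = f"
    using assms(4,5) by (auto simp: indicator_def fun_eq_iff)
  have m: "f \<in> borel_measurable lborel"
    using borel_measurable_continuous_onI[OF assms(2)] by simp
  have o: "\<Omega> \<inter> space lebesgue \<in> sets lebesgue" using assms(1) by auto
  have i: "integrable lborel f"
    using integrable_lborel_compact_support[OF assms(2,3,5)] .
  show "integrable (lebesgue_on \<Omega>) f"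
    using i integrable_completion[OF m] integrable_restrict_space[OF o, of f] eq by simp
  show "(LINT x|lebesgue_on \<Omega>. f x) = (LINT x|lborel. f x)"
    using integral_completion[OF m] integral_restrict_space[OF o, of f] eq by simp
qed

lemma test_function_continuous: "\<phi> \<in> test_functions \<Omega> \<Longrightarrow> continuous_on UNIV \<phi>"
  by (auto simp: test_functions_def intro: C_k_imp_continuous)

lemma test_function_differentiable: "\<phi> \<in> test_functions \<Omega> \<Longrightarrow> \<phi> differentiable (at x)"
  unfolding test_functions_def using C_k_Suc_differentiable[of 0 \<phi>] by blast

lemma integrable_test_function:
  assumes "open \<Omega>" "\<phi> \<in> test_functions \<Omega>"
  shows "integrable (lebesgue_on \<Omega>) \<phi>"
proof -
  obtain C where "compact C" "C \<subseteq> \<Omega>" "\<forall>x. x \<notin> C \<longrightarrow> \<phi> x = 0"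
    using test_functionsE[OF assms(2)] by blast
  then show ?thesis
    using assms test_function_continuous[OF assms(2)]
    by (intro lebesgue_on_compact_support(1)[of _ _ C]) auto
qed

lemma integral_partial_deriv_test_function:
  assumes "open \<Omega>" "\<phi> \<in> test_functions \<Omega>"
  shows "(LINT x|lebesgue_on \<Omega>. partial_deriv j \<phi> x) = 0"
proof -
  obtain C where C: "\<forall>k. C_k k \<phi>" "compact C" "C \<subseteq> \<Omega>" "\<forall>x. x \<notin> C \<longrightarrow> \<phi> x = 0"
    using test_functionsE[OF assms(2)] by blast
  have "(LINT x|lebesgue_on \<Omega>. partial_deriv j \<phi> x) = (LINT x|lborel. partial_deriv j \<phi> x)"
    using assms C test_function_partial_deriv[OF assms(2)]
    by (intro lebesgue_on_compact_support[of _ _ C])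
       (auto intro!: test_function_continuous partial_deriv_outside_support[of C] compact_imp_closed)
  also have "\<dots> = 0"
    using C by (intro integral_partial_deriv_eq_0[of _ C]) auto
  finally show ?thesis .
qed

text \<open>Only the product of the two functions needs compact support, since it is the partial
  derivative of the product that integrates to zero. Hence \<open>f\<close> may be a coordinate
  function, as in the Poincare inequality.\<close>

lemma integral_by_parts_test_functions:
  assumes "open \<Omega>" "\<And>k. C_k k f" "\<phi> \<in> test_functions \<Omega>"
  shows "(LINT x|lebesgue_on \<Omega>. f x * partial_deriv j \<phi> x) =
      - (LINT x|lebesgue_on \<Omega>. partial_deriv j f x * \<phi> x)"
proof -
  have d: "C_k k (partial_deriv j f)" for k using assms(2)[of "Suc k"] by simp
  have "0 = (LINT x|lebesgue_on \<Omega>. partial_deriv j (\<lambda>x. f x * \<phi> x) x)"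
    using integral_partial_deriv_test_function[OF assms(1) test_functions_mult[OF assms(2,3)]] by simp
  also have "\<dots> = (LINT x|lebesgue_on \<Omega>. f x * partial_deriv j \<phi> x + partial_deriv j f x * \<phi> x)"
    using assms(2)[THEN C_k_Suc_differentiable] test_function_differentiable[OF assms(3)]
    by (subst partial_deriv_mult) auto
  also have "\<dots> = (LINT x|lebesgue_on \<Omega>. f x * partial_deriv j \<phi> x) +
      (LINT x|lebesgue_on \<Omega>. partial_deriv j f x * \<phi> x)"
    using assms d
    by (intro Bochner_Integration.integral_add integrable_test_function test_functions_mult
        test_function_partial_deriv) auto
  finally show ?thesis by simp
qed

section \<open>Square integrable functions and the fundamental lemma\<close>

text \<open>The common core of three arguments: the Cauchy-Schwarz inequality, the Euler-Lagrange
  equation of a minimising sequence, and the eigenvector equation for a minimiser of the Rayleigh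
  quotient.\<close>

lemma quadratic_nonneg_imp_discriminant_le:
  fixes a b c :: real
  assumes "\<And>t. 0 \<le> a + 2 * t * b + t\<^sup>2 * c" "0 \<le> c"
  shows "b\<^sup>2 \<le> a * c"
proof (cases "c = 0")
  case True
  have "b = 0"
  proof (rule ccontr)
    assume "b \<noteq> 0"
    \<comment> \<open>At this \<open>t\<close> the affine function a + 2 t b takes the value
      -1.\<close>
    then show False using assms(1)[of "- (a + 1) / (2 * b)"] True by (simp add: field_simps)
  qed
  then show ?thesis using True by simp
next
  case False
  then have "c > 0" using assms by simp
  then show ?thesis using assms(1)[of "- b / c"]
    by (simp add: field_simps power2_eq_square)
qed

text \<open>Stated for any measure and any Euclidean codomain, so that functions and their gradient
  fields share one theory.\<close>

definition square_integrable :: "'a measure \<Rightarrow> ('a \<Rightarrow> 'b::euclidean_space) \<Rightarrow> bool" where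
  "square_integrable M f \<longleftrightarrow> f \<in> borel_measurable M \<and> integrable M (\<lambda>x. (norm (f x))\<^sup>2)"

lemma square_integrable_inner:
  assumes "square_integrable M f" "square_integrable M g"
  shows "integrable M (\<lambda>x. f x \<bullet> g x)"
proof (rule Bochner_Integration.integrable_bound)
  show "integrable M (\<lambda>x. (norm (f x))\<^sup>2 + (norm (g x))\<^sup>2)"
    using assms by (auto simp: square_integrable_def)
  show "(\<lambda>x. f x \<bullet> g x) \<in> borel_measurable M"
    using assms by (auto simp: square_integrable_def intro: borel_measurable_inner)
  have "\<bar>u \<bullet> v\<bar> \<le> \<bar>(norm u)\<^sup>2 + (norm v)\<^sup>2\<bar>" for u v :: 'b
  proof -
    have "\<bar>u \<bullet> v\<bar> \<le> norm u * norm v" by (rule Cauchy_Schwarz_ineq2)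
    moreover have "2 * (norm u * norm v) \<le> (norm u)\<^sup>2 + (norm v)\<^sup>2"
      using sum_squares_bound[of "norm u" "norm v"] by simp
    moreover have "0 \<le> norm u * norm v" by simp
    ultimately show ?thesis by linarith
  qed
  then show "AE x in M. norm (f x \<bullet> g x) \<le> norm ((norm (f x))\<^sup>2 + (norm (g x))\<^sup>2)"
    by simp
qed

lemma square_integrable_scale:
  "square_integrable M f \<Longrightarrow> square_integrable M (\<lambda>x. c *\<^sub>R f x)"
  by (auto simp: square_integrable_def power_mult_distrib)

lemma square_integrable_add:
  assumes "square_integrable M f" "square_integrable M g"
  shows "square_integrable M (\<lambda>x. f x + g x)"
proof -
  have "integrable M (\<lambda>x. (norm (f x))\<^sup>2 + (norm (g x))\<^sup>2 + 2 * (f x \<bullet> g x))"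
    using assms square_integrable_inner[OF assms] by (auto simp: square_integrable_def)
  moreover have "(norm (f x + g x))\<^sup>2 = (norm (f x))\<^sup>2 + (norm (g x))\<^sup>2 + 2 * (f x \<bullet> g x)" for x
    by (simp add: power2_norm_eq_inner inner_add_left inner_add_right inner_commute)
  ultimately show ?thesis using assms by (auto simp: square_integrable_def)
qed

lemma square_integrable_diff:
  assumes "square_integrable M f" "square_integrable M g"
  shows "square_integrable M (\<lambda>x. f x - g x)"
  using square_integrable_add[OF assms(1) square_integrable_scale[OF assms(2), of "-1"]] by simp

lemma integral_Cauchy_Schwarz:
  assumes f: "square_integrable M f" and g: "square_integrable M g"
  shows "(LINT x|M. f x \<bullet> g x)\<^sup>2 \<le> (LINT x|M. (norm (f x))\<^sup>2) * (LINT x|M. (norm (g x))\<^sup>2)"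
proof (rule quadratic_nonneg_imp_discriminant_le)
  fix t :: real
  have "0 \<le> (LINT x|M. (norm (f x + t *\<^sub>R g x))\<^sup>2)" by simp
  also have "\<dots> = (LINT x|M. (norm (f x))\<^sup>2 + 2 * t * (f x \<bullet> g x) + t\<^sup>2 * (norm (g x))\<^sup>2)"
    by (intro Bochner_Integration.integral_cong refl)
       (simp only: power2_norm_eq_inner inner_add_left inner_add_right inner_scaleR_left
          inner_scaleR_right inner_commute, simp add: power2_eq_square algebra_simps)
  also have "\<dots> = (LINT x|M. (norm (f x))\<^sup>2) + 2 * t * (LINT x|M. f x \<bullet> g x) +
      t\<^sup>2 * (LINT x|M. (norm (g x))\<^sup>2)"
    using square_integrable_inner[OF f g] f g
    by (auto simp: square_integrable_def)
  finally show "0 \<le> (LINT x|M. (norm (f x))\<^sup>2) + 2 * t * (LINT x|M. f x \<bullet> g x) +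
      t\<^sup>2 * (LINT x|M. (norm (g x))\<^sup>2)" .
qed simp

lemma (in finite_measure) square_integrable_const: "square_integrable M (\<lambda>_. c)"
  by (simp add: square_integrable_def)

lemma (in finite_measure) square_integrable_imp_integrable_norm:
  assumes "square_integrable M f"
  shows "integrable M (\<lambda>x. norm (f x))"
proof -
  have "square_integrable M (\<lambda>x. norm (f x))"
    using assms by (auto simp: square_integrable_def)
  from square_integrable_inner[OF this square_integrable_const[of 1]] show ?thesis by simp
qed

text \<open>Riesz-Fischer: on a finite measure space, L2 control of consecutive differences gives L1
  control, so a fast subsequence converges almost everywhere. Fatou's lemma upgrades this pointwise
  limit to an L2 limit of the full sequence.\<close>

lemma (in finite_measure) L2_complete:
  fixes F :: "nat \<Rightarrow> 'a \<Rightarrow> 'b::euclidean_space"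
  assumes F: "\<And>n. square_integrable M (F n)"
    and Cauchy: "\<And>e. 0 < e \<Longrightarrow> \<exists>N. \<forall>m\<ge>N. \<forall>n\<ge>N. (LINT x|M. (norm (F m x - F n x))\<^sup>2) < e"
  shows "\<exists>f. square_integrable M f \<and> (\<lambda>n. LINT x|M. (norm (F n x - f x))\<^sup>2) \<longlonglongrightarrow> 0"
proof -
  have meas[measurable]: "F n \<in> borel_measurable M" for n
    using F by (simp add: square_integrable_def)
  have FF: "square_integrable M (\<lambda>x. F m x - F n x)" for m n
    using F by (intro square_integrable_diff)
  \<comment> \<open>The bound concerns squared norms; its root (1/2)^k is what has to be
    summable.\<close>
  have "\<forall>k. \<exists>N. \<forall>m\<ge>N. \<forall>n\<ge>N. (LINT x|M. (norm (F m x - F n x))\<^sup>2) < (1/4) ^ k"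
    using Cauchy by simp
  then obtain N where N: "\<And>k m n. N k \<le> m \<Longrightarrow> N k \<le> n \<Longrightarrow> (LINT x|M. (norm (F m x - F n x))\<^sup>2) < (1/4) ^ k"
    by metis
  \<comment> \<open>The partial sums make \<open>r\<close> monotone and at least \<open>N k\<close>;
    the summand \<open>k\<close> makes it unbounded, so that it eventually exceeds the threshold
    \<open>K\<close> in the Fatou step.\<close>
  define r where "r k = k + (\<Sum>i\<le>k. N i)" for k
  have r: "N k \<le> r k" "r k \<le> r (Suc k)" "k \<le> r k" for k
    by (auto simp: r_def intro: trans_le_add2 member_le_sum)
  define D where "D k x = F (r (Suc k)) x - F (r k) x" for k x
  have Dm[measurable]: "D k \<in> borel_measurable M" for k unfolding D_def by measurable
  define c where "c = sqrt (measure M (space M))"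
  have D: "(LINT x|M. norm (D k x)) \<le> c * (1/2) ^ k" for k
  proof -
    have sq: "square_integrable M (\<lambda>x. norm (D k x))"
      using FF by (auto simp: square_integrable_def D_def)
    have "(LINT x|M. norm (D k x))\<^sup>2 \<le> (LINT x|M. (norm (D k x))\<^sup>2) * measure M (space M)"
      using integral_Cauchy_Schwarz[OF sq square_integrable_const[of 1]] by simp
    also have "\<dots> \<le> (1/4) ^ k * measure M (space M)"
      unfolding D_def using N[of k "r (Suc k)" "r k"] r[of k] by (intro mult_right_mono) auto
    also have "\<dots> = (c * (1/2) ^ k)\<^sup>2"
      by (simp add: c_def power_mult_distrib power_divide power2_eq_square flip: power_mult_distrib)
    finally show ?thesis
      by (rule power2_le_imp_le) (simp add: c_def)
  qed
  have "(\<integral>\<^sup>+x. (\<Sum>k. ennreal (norm (D k x))) \<partial>M) = (\<Sum>k. \<integral>\<^sup>+x. ennreal (norm (D k x)) \<partial>M)"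
    by (rule nn_integral_suminf) measurable
  also have "\<dots> = (\<Sum>k. ennreal (LINT x|M. norm (D k x)))"
    using FF by (intro suminf_cong nn_integral_eq_integral square_integrable_imp_integrable_norm)
      (auto simp: D_def)
  also have "\<dots> \<le> (\<Sum>k. ennreal (c * (1/2) ^ k))"
    using D by (intro suminf_le ennreal_leI) auto
  also have "\<dots> < \<infinity>"
    by (subst suminf_ennreal2) (auto simp: c_def)
  finally have "(\<integral>\<^sup>+x. (\<Sum>k. ennreal (norm (D k x))) \<partial>M) \<noteq> \<infinity>" by simp
  then have "AE x in M. (\<Sum>k. ennreal (norm (D k x))) \<noteq> \<infinity>"
    by (intro nn_integral_PInf_AE) measurable
  then have conv: "AE x in M. convergent (\<lambda>k. F (r k) x)"
  proof eventually_elim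
    case (elim x)
    then have "summable (\<lambda>k. norm (D k x))"
      by (intro summable_suminf_not_top) auto
    then have "summable (\<lambda>k. D k x)" by (rule summable_norm_cancel)
    then have "convergent (\<lambda>n. F (r n) x - F (r 0) x)"
      using sum_lessThan_telescope[of "\<lambda>n. F (r n) x"] by (simp add: D_def summable_iff_convergent)
    then show ?case by (simp add: convergent_diff_const_right_iff)
  qed
  define f where "f x = lim (\<lambda>k. F (r k) x)" for x
  have fm[measurable]: "f \<in> borel_measurable M" unfolding f_def by measurable
  have lim: "AE x in M. (\<lambda>k. F (r k) x) \<longlonglongrightarrow> f x"
    using conv by eventually_elim (simp add: f_def convergent_LIMSEQ_iff)
  \<comment> \<open>Kept in the extended nonnegative integral: integrability of
    \<open>F n - f\<close> is not known yet and is deduced from this bound.\<close>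
  have key: "(\<integral>\<^sup>+x. ennreal ((norm (F n x - f x))\<^sup>2) \<partial>M) \<le> ennreal e"
    if e: "\<And>k. K \<le> k \<Longrightarrow> (LINT x|M. (norm (F n x - F k x))\<^sup>2) < e" for n e K
  proof -
    have "AE x in M. ennreal ((norm (F n x - f x))\<^sup>2) =
        liminf (\<lambda>k. ennreal ((norm (F n x - F (r k) x))\<^sup>2))"
      using lim
    proof eventually_elim
      case (elim x)
      then have "(\<lambda>k. ennreal ((norm (F n x - F (r k) x))\<^sup>2)) \<longlonglongrightarrow> ennreal ((norm (F n x - f x))\<^sup>2)"
        by (intro tendsto_intros tendsto_ennrealI)
      then show ?case by (rule lim_imp_Liminf[OF trivial_limit_sequentially, symmetric])
    qed
    then have "(\<integral>\<^sup>+x. ennreal ((norm (F n x - f x))\<^sup>2) \<partial>M) =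
        (\<integral>\<^sup>+x. liminf (\<lambda>k. ennreal ((norm (F n x - F (r k) x))\<^sup>2)) \<partial>M)"
      by (rule nn_integral_cong_AE)
    also have "\<dots> \<le> liminf (\<lambda>k. \<integral>\<^sup>+x. ennreal ((norm (F n x - F (r k) x))\<^sup>2) \<partial>M)"
      by (intro nn_integral_liminf) measurable
    also have "\<dots> = liminf (\<lambda>k. ennreal (LINT x|M. (norm (F n x - F (r k) x))\<^sup>2))"
      using FF by (subst nn_integral_eq_integral) (auto simp: square_integrable_def)
    also have "\<dots> \<le> liminf (\<lambda>k. ennreal e)"
    proof (rule Liminf_mono, rule eventually_sequentiallyI[of K])
      fix k assume "K \<le> k"
      then have "K \<le> r k" using r(3)[of k] by simp
      then show "ennreal (LINT x|M. (norm (F n x - F (r k) x))\<^sup>2) \<le> ennreal e"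
        using e by (intro ennreal_leI) (auto intro: less_imp_le)
    qed
    also have "\<dots> = ennreal e" by (simp add: Liminf_const)
    finally show ?thesis .
  qed
  have sqd: "\<exists>N. \<forall>n\<ge>N. square_integrable M (\<lambda>x. F n x - f x) \<and> (LINT x|M. (norm (F n x - f x))\<^sup>2) \<le> e"
    if "0 < e" for e
  proof -
    obtain K where K: "\<And>m n. K \<le> m \<Longrightarrow> K \<le> n \<Longrightarrow> (LINT x|M. (norm (F m x - F n x))\<^sup>2) < e"
      using Cauchy[OF \<open>0 < e\<close>] by metis
    show ?thesis
    proof (intro exI[of _ K] allI impI)
      fix n assume "K \<le> n"
      then have *: "(\<integral>\<^sup>+x. ennreal ((norm (F n x - f x))\<^sup>2) \<partial>M) \<le> ennreal e"
        using K by (intro key[of K]) auto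
      then have i: "integrable M (\<lambda>x. (norm (F n x - f x))\<^sup>2)"
        by (intro integrableI_nonneg) (auto simp: top_unique intro: le_less_trans)
      then have "ennreal (LINT x|M. (norm (F n x - f x))\<^sup>2) \<le> ennreal e"
        using * by (subst (asm) nn_integral_eq_integral) auto
      then show "square_integrable M (\<lambda>x. F n x - f x) \<and> (LINT x|M. (norm (F n x - f x))\<^sup>2) \<le> e"
        using i \<open>0 < e\<close> by (auto simp: square_integrable_def)
    qed
  qed
  obtain n where "square_integrable M (\<lambda>x. F n x - f x)"
    using sqd[of 1] by auto
  from square_integrable_diff[OF F[of n] this] have "square_integrable M f" by simp
  moreover have "(\<lambda>n. LINT x|M. (norm (F n x - f x))\<^sup>2) \<longlonglongrightarrow> 0"
  proof (rule LIMSEQ_I)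
    fix e :: real assume "0 < e"
    then show "\<exists>N. \<forall>n\<ge>N. norm ((LINT x|M. (norm (F n x - f x))\<^sup>2) - 0) < e"
      using sqd[of "e/2"] by fastforce
  qed
  ultimately show ?thesis by blast
qed

text \<open>The positive and negative parts of \<open>g\<close>, taken as densities, define measures
  that agree on boxes. Boxes form an intersection-stable generator of the Borel sets, so the
  measures coincide, and with them the densities almost everywhere.\<close>

lemma AE_eq_0_of_integral_boxes:
  fixes g :: "'a::euclidean_space \<Rightarrow> real"
  assumes g: "integrable lborel g"
    and boxes: "\<And>c d. (LINT x|lborel. indicator (box c d) x * g x) = 0"
  shows "AE x in lborel. g x = 0"
proof -
  have gm[measurable]: "g \<in> borel_measurable borel" using g by auto
  let ?p = "\<lambda>x. ennreal (g x)" and ?n = "\<lambda>x. ennreal (- g x)"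
  let ?E = "range (\<lambda>(a, b). box a b :: 'a set)"
  have eq: "emeasure (density lborel ?p) (box c d) = emeasure (density lborel ?n) (box c d)"
    and fin: "emeasure (density lborel ?p) (box c d) \<noteq> \<infinity>" for c d
  proof -
    have i: "integrable lborel (\<lambda>x. indicator (box c d) x * g x)"
      using integrable_mult_indicator[OF _ g, of "box c d"] by simp
    have "emeasure (density lborel (\<lambda>x. ennreal (s * g x))) (box c d) =
        ennreal (LINT x|lborel. max 0 (s * (indicator (box c d) x * g x)))" for s
    proof -
      have "emeasure (density lborel (\<lambda>x. ennreal (s * g x))) (box c d) =
          (\<integral>\<^sup>+x. ennreal (max 0 (s * (indicator (box c d) x * g x))) \<partial>lborel)"
        by (subst emeasure_density)
           (auto intro!: nn_integral_cong split: split_indicator simp: max_def ennreal_neg)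
      also have "\<dots> = ennreal (LINT x|lborel. max 0 (s * (indicator (box c d) x * g x)))"
        using i by (intro nn_integral_eq_integral) auto
      finally show ?thesis .
    qed
    from this[of 1] this[of "-1"] have
      p: "emeasure (density lborel ?p) (box c d) =
        ennreal (LINT x|lborel. max 0 (indicator (box c d) x * g x))" and
      n: "emeasure (density lborel ?n) (box c d) =
        ennreal (LINT x|lborel. max 0 (- (indicator (box c d) x * g x)))"
      by simp_all
    have "(LINT x|lborel. max 0 (indicator (box c d) x * g x)) -
        (LINT x|lborel. max 0 (- (indicator (box c d) x * g x))) =
        (LINT x|lborel. max 0 (indicator (box c d) x * g x) - max 0 (- (indicator (box c d) x * g x)))"
      using i by (subst Bochner_Integration.integral_diff) auto
    also have "\<dots> = (LINT x|lborel. indicator (box c d) x * g x)"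
      by (intro Bochner_Integration.integral_cong) auto
    finally show "emeasure (density lborel ?p) (box c d) = emeasure (density lborel ?n) (box c d)"
      using p n boxes by simp
    show "emeasure (density lborel ?p) (box c d) \<noteq> \<infinity>" using p by simp
  qed
  have "density lborel ?p = density lborel ?n"
  proof (rule measure_eqI_generator_eq)
    show "Int_stable ?E" by (auto simp: Int_stable_def box_Int_box)
    show "?E \<subseteq> Pow UNIV" "sets (density lborel ?p) = sigma_sets UNIV ?E"
      "sets (density lborel ?n) = sigma_sets UNIV ?E"
      by (simp_all add: borel_eq_box)
    let ?A = "\<lambda>n::nat. box (- (real n *\<^sub>R One)) (real n *\<^sub>R One) :: 'a set"
    show "range ?A \<subseteq> ?E" "(\<Union>i. ?A i) = UNIV"
      unfolding UN_box_eq_UNIV by auto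
    show "emeasure (density lborel ?p) (?A i) \<noteq> \<infinity>" for i by (rule fin)
    show "emeasure (density lborel ?p) X = emeasure (density lborel ?n) X" if "X \<in> ?E" for X
      using that eq by auto
  qed
  then have "AE x in lborel. ?p x = ?n x"
    by (intro sigma_finite_measure.density_unique[OF sigma_finite_lborel]) auto
  \<comment> \<open>\<open>ennreal\<close> truncates negative reals to 0, so at each point one side
    of the equation is 0 and the equality forces \<open>g x = 0\<close>.\<close>
  then show ?thesis
  proof eventually_elim
    case (elim x)
    then show ?case by (cases "0 \<le> g x") (auto simp: ennreal_neg)
  qed
qed

text \<open>
  Bumps converge to indicators of boxes, so \<open>h\<close> integrates to zero over every box whose closure
  lies in \<open>\<Omega>\<close>.
\<close>

lemma fundamental_lemma_variations:
  assumes \<Omega>: "open \<Omega>" and h: "integrable (lebesgue_on \<Omega>) h"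
    and zero: "\<And>\<phi>. \<phi> \<in> test_functions \<Omega> \<Longrightarrow> (LINT x|lebesgue_on \<Omega>. h x * \<phi> x) = 0"
  shows "AE x in lebesgue_on \<Omega>. h x = 0"
proof -
  let ?L = "lebesgue_on \<Omega>"
  have \<Omega>L: "\<Omega> \<inter> space lebesgue \<in> sets lebesgue" using \<Omega> by auto
  have hm[measurable]: "h \<in> borel_measurable ?L" using h by auto
  have L_meas: "f \<in> borel_measurable ?L" if "f \<in> borel_measurable borel" for f :: "real^'a \<Rightarrow> real"
    using that by (intro measurable_restrict_space1 measurable_completion) simp
  have box0: "(LINT x|?L. h x * indicator (box a b) x) = 0" if "cbox a b \<subseteq> \<Omega>" for a b
  proof -
    have "(\<lambda>n. LINT x|?L. h x * bump n a b x) \<longlonglongrightarrow> (LINT x|?L. h x * indicator (box a b) x)"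
    proof (rule integral_dominated_convergence[where w = "\<lambda>x. \<bar>h x\<bar>"])
      have "bump n a b \<in> borel_measurable borel" for n
        by (intro borel_measurable_continuous_onI C_k_imp_continuous[of 0] C_k_bump)
      then show "(\<lambda>x. h x * bump n a b x) \<in> borel_measurable ?L" for n
        by (intro borel_measurable_times hm L_meas)
      show "(\<lambda>x. h x * indicator (box a b) x) \<in> borel_measurable ?L"
        by (intro borel_measurable_times hm L_meas) auto
      show "AE x in ?L. (\<lambda>n. h x * bump n a b x) \<longlonglongrightarrow> h x * indicator (box a b) x"
        by (intro AE_I2 tendsto_intros bump_tendsto_indicator)
      show "AE x in ?L. norm (h x * bump n a b x) \<le> \<bar>h x\<bar>" for n
        using bump_bounds[of n a b] by (intro AE_I2) (simp add: abs_mult mult_left_le)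
    qed (use h in auto)
    then show ?thesis unfolding zero[OF bump_test_function[OF that]] by (simp add: LIMSEQ_const_iff)
  qed
  \<comment> \<open>\<open>h\<close> is only Lebesgue measurable and lives on the domain; extending
    it by zero and passing to a Borel representative gives a function on \<open>lborel\<close> to
    which the box criterion applies.\<close>
  define g0 where "g0 x = indicator \<Omega> x * h x" for x
  have g0: "integrable lebesgue g0"
    using h integrable_restrict_space[OF \<Omega>L, of h] by (simp add: g0_def[abs_def])
  then obtain g where g[measurable]: "g \<in> borel_measurable lborel" and gg0: "AE x in lborel. g0 x = g x"
    using completion_ex_borel_measurable_real[of g0 lborel] by auto
  have gg0': "AE x in lebesgue. g0 x = g x" using gg0 by (rule AE_completion)
  have ig: "integrable lborel g"
  proof -
    have "integrable lebesgue g"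
      using g0 gg0' g by (subst integrable_cong_AE[of _ _ g0]) (auto intro: measurable_completion)
    then show ?thesis using g by (simp add: integrable_completion)
  qed
  \<comment> \<open>The box criterion asks for all boxes, but \<open>box0\<close> covers only those
    with closure in the domain. Cutting \<open>g\<close> off to \<open>box a b\<close> repairs this:
    a box intersected with \<open>box a b\<close> is a box whose closure lies in
    \<open>cbox a b\<close>.\<close>
  have AE_cbox: "AE x in lborel. x \<in> cbox a b \<longrightarrow> g x = 0" if ab: "cbox a b \<subseteq> \<Omega>" for a b
  proof -
    let ?gb = "\<lambda>x. indicator (box a b) x * g x"
    have "AE x in lborel. ?gb x = 0"
    proof (rule AE_eq_0_of_integral_boxes)
      show "integrable lborel ?gb"
        using integrable_mult_indicator[OF _ ig, of "box a b"] by simp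
      fix c d
      obtain a' b' where ab': "box c d \<inter> box a b = box a' b'" 
        using box_Int_box[of c d a b] by blast
      have "(LINT x|lborel. indicator (box c d) x * ?gb x) = (LINT x|lborel. g x * indicator (box a' b') x)"
        using ab' by (intro Bochner_Integration.integral_cong) (auto split: split_indicator)
      also have "\<dots> = (LINT x|lebesgue. g x * indicator (box a' b') x)"
        by (rule integral_completion[symmetric]) measurable
      also have "\<dots> = (LINT x|lebesgue. g0 x * indicator (box a' b') x)"
        using gg0' g0 g
        by (intro integral_cong_AE borel_measurable_times) (auto intro: measurable_completion)
      also have "\<dots> = (LINT x|?L. h x * indicator (box a' b') x)"
        by (subst integral_restrict_space[OF \<Omega>L]) (simp add: g0_def mult.assoc)
      also have "\<dots> = 0"
      proof (cases "box a' b' = {}")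
        case False
        then have "cbox a' b' = closure (box a' b')" by simp
        also have "\<dots> \<subseteq> cbox a b"
          using ab' box_subset_cbox[of a b] by (intro closure_minimal closed_cbox) auto
        finally show ?thesis using ab by (intro box0) auto
      qed simp
      finally show "(LINT x|lborel. indicator (box c d) x * ?gb x) = 0" .
    qed
    \<comment> \<open>The cut-off says nothing on the boundary of the box, which is a null
      set.\<close>
    moreover have "AE x in lborel. x \<notin> cbox a b - box a b"
    proof -
      have "cbox a b - box a b \<in> null_sets lebesgue"
        using negligible_frontier_interval by (simp add: negligible_iff_null_sets)
      then have "cbox a b - box a b \<in> null_sets lborel"
        by (subst (asm) null_sets_completion_iff) auto
      then show ?thesis by (rule AE_not_in)
    qed
    ultimately show ?thesis by eventually_elim auto
  qed
  \<comment> \<open>Countability of the cover allows the exceptional null sets to be united.\<close>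
  obtain \<D> where \<D>: "countable \<D>" "\<D> \<subseteq> Pow \<Omega>" "\<And>X. X \<in> \<D> \<Longrightarrow> \<exists>a b. X = cbox a b" "\<Union>\<D> = \<Omega>"
    using open_countable_Union_open_cbox[OF \<Omega>] by metis
  have "AE x in lborel. x \<in> X \<longrightarrow> g x = 0" if X: "X \<in> \<D>" for X
  proof -
    obtain a b where "X = cbox a b" using \<D>(3)[OF X] by blast
    moreover have "X \<subseteq> \<Omega>" using \<D>(2) X by blast
    ultimately show ?thesis using AE_cbox by simp
  qed
  then have "AE x in lborel. \<forall>X\<in>\<D>. x \<in> X \<longrightarrow> g x = 0"
    unfolding AE_ball_countable[OF \<D>(1)] by blast
  then have "AE x in lborel. x \<in> \<Omega> \<longrightarrow> h x = 0"
    using gg0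
  proof eventually_elim
    case (elim x)
    show ?case
    proof
      assume x: "x \<in> \<Omega>"
      then have "g x = 0" using elim(1) \<D>(4) by blast
      then show "h x = 0" using elim(2) x by (simp add: g0_def)
    qed
  qed
  then show ?thesis
    unfolding AE_restrict_space_iff[OF \<Omega>L] by (rule AE_completion)
qed

section \<open>Weak gradients\<close>

text \<open>Square integrability belongs to the notion because the Bochner integral of a
  non-integrable function is 0; convergence of the integrals alone would carry no
  information.\<close>

definition L2_lim :: "'a measure \<Rightarrow> (nat \<Rightarrow> 'a \<Rightarrow> 'b::euclidean_space) \<Rightarrow> ('a \<Rightarrow> 'b) \<Rightarrow> bool" where
  "L2_lim M F f \<longleftrightarrow> (\<forall>n. square_integrable M (F n)) \<and> square_integrable M f \<and>
     (\<lambda>n. LINT x|M. (norm (F n x - f x))\<^sup>2) \<longlonglongrightarrow> 0"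

text \<open>Cauchy-Schwarz shows that strong convergence implies weak convergence. All passages to
  the limit in weak gradients and weak equations go through this.\<close>

lemma L2_lim_inner:
  assumes "L2_lim M F f" "square_integrable M g"
  shows "(\<lambda>n. LINT x|M. F n x \<bullet> g x) \<longlonglongrightarrow> (LINT x|M. f x \<bullet> g x)"
proof -
  have F: "square_integrable M (F n)" and f: "square_integrable M f"
    and lim: "(\<lambda>n. LINT x|M. (norm (F n x - f x))\<^sup>2) \<longlonglongrightarrow> 0" for n
    using assms(1) by (auto simp: L2_lim_def)
  have "(\<lambda>n. (LINT x|M. (norm (F n x - f x))\<^sup>2) * (LINT x|M. (norm (g x))\<^sup>2)) \<longlonglongrightarrow> 0"
    using tendsto_mult_left_zero[OF lim] .
  then have "(\<lambda>n. (LINT x|M. (F n x - f x) \<bullet> g x)\<^sup>2) \<longlonglongrightarrow> 0"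
    by (rule tendsto_sandwich[OF _ _ tendsto_const, rotated 2])
       (use F f assms(2) in \<open>auto intro!: always_eventually integral_Cauchy_Schwarz square_integrable_diff\<close>)
  then have "(\<lambda>n. LINT x|M. (F n x - f x) \<bullet> g x) \<longlonglongrightarrow> 0"
    by (simp add: power_tendsto_0_iff)
  moreover have "(LINT x|M. (F n x - f x) \<bullet> g x) = (LINT x|M. F n x \<bullet> g x) - (LINT x|M. f x \<bullet> g x)" for n
    using F f assms(2) by (simp add: inner_diff_left square_integrable_inner)
  ultimately show ?thesis by (simp add: LIM_zero_iff)
qed

text \<open>Replaces the triangle inequality of the L2 norm at the price of a factor 2, and avoids
  square roots.\<close>

lemma integral_norm_add_le:
  assumes "square_integrable M f" "square_integrable M g"
  shows "(LINT x|M. (norm (f x + g x))\<^sup>2) \<le> 2 * (LINT x|M. (norm (f x))\<^sup>2) + 2 * (LINT x|M. (norm (g x))\<^sup>2)"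
proof -
  have fg: "integrable M (\<lambda>x. (norm (f x))\<^sup>2)" "integrable M (\<lambda>x. (norm (g x))\<^sup>2)"
    using assms by (auto simp: square_integrable_def)
  have "(norm (u + v))\<^sup>2 \<le> 2 * (norm u)\<^sup>2 + 2 * (norm v)\<^sup>2" for u v :: 'b
  proof -
    have "(norm (u + v))\<^sup>2 \<le> (norm u + norm v)\<^sup>2"
      by (intro power_mono norm_triangle_ineq) auto
    also have "\<dots> \<le> 2 * (norm u)\<^sup>2 + 2 * (norm v)\<^sup>2"
      using sum_squares_bound[of "norm u" "norm v"] by (simp add: power2_sum)
    finally show ?thesis .
  qed
  then have "(LINT x|M. (norm (f x + g x))\<^sup>2) \<le> (LINT x|M. 2 * (norm (f x))\<^sup>2 + 2 * (norm (g x))\<^sup>2)"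
    using square_integrable_add[OF assms] fg
    by (intro integral_mono) (auto simp: square_integrable_def)
  also have "\<dots> = 2 * (LINT x|M. (norm (f x))\<^sup>2) + 2 * (LINT x|M. (norm (g x))\<^sup>2)"
    using fg by simp
  finally show ?thesis .
qed

lemma L2_lim_add:
  assumes "L2_lim M F f" "L2_lim M G g"
  shows "L2_lim M (\<lambda>n x. F n x + G n x) (\<lambda>x. f x + g x)"
proof -
  have sq: "square_integrable M (F n)" "square_integrable M f"
    "square_integrable M (G n)" "square_integrable M g" for n
    using assms by (auto simp: L2_lim_def)
  let ?b = "\<lambda>n. 2 * (LINT x|M. (norm (F n x - f x))\<^sup>2) + 2 * (LINT x|M. (norm (G n x - g x))\<^sup>2)"
  have "?b \<longlonglongrightarrow> 2 * 0 + 2 * 0"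
    using assms unfolding L2_lim_def by (intro tendsto_add tendsto_mult tendsto_const) blast+
  then have lim: "?b \<longlonglongrightarrow> 0" by simp
  have le: "(LINT x|M. (norm (F n x + G n x - (f x + g x)))\<^sup>2) \<le> ?b n" for n
    using integral_norm_add_le[OF square_integrable_diff[OF sq(1,2), of n] square_integrable_diff[OF sq(3,4), of n]]
    by (simp only: add_diff_add)
  have "(\<lambda>n. LINT x|M. (norm (F n x + G n x - (f x + g x)))\<^sup>2) \<longlonglongrightarrow> 0"
    by (rule tendsto_sandwich[OF always_eventually always_eventually tendsto_const lim]) (use le in simp_all)
  then show ?thesis using sq by (simp add: L2_lim_def square_integrable_add)
qed

lemma L2_lim_scale:
  assumes "L2_lim M F f"
  shows "L2_lim M (\<lambda>n x. c *\<^sub>R F n x) (\<lambda>x. c *\<^sub>R f x)"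
proof -
  have "(LINT x|M. (norm (c *\<^sub>R F n x - c *\<^sub>R f x))\<^sup>2) = c\<^sup>2 * (LINT x|M. (norm (F n x - f x))\<^sup>2)" for n
    by (simp add: power_mult_distrib flip: scaleR_diff_right)
  moreover have "(\<lambda>n. c\<^sup>2 * (LINT x|M. (norm (F n x - f x))\<^sup>2)) \<longlonglongrightarrow> 0"
    using assms by (intro tendsto_mult_right_zero) (simp add: L2_lim_def)
  ultimately show ?thesis
    using assms by (simp add: L2_lim_def square_integrable_scale)
qed

lemma L2_lim_const: "square_integrable M f \<Longrightarrow> L2_lim M (\<lambda>_. f) f"
  by (simp add: L2_lim_def)

text \<open>The classical gradient. In contrast to the chosen representative \<open>wgrad\<close>,
  it is linear at every point on test functions.\<close>

definition grad :: "(real^'d::finite \<Rightarrow> real) \<Rightarrow> real^'d \<Rightarrow> real^'d" where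
  "grad \<phi> x = (\<chi> j. partial_deriv j \<phi> x)"

lemma grad_add:
  assumes "\<phi> \<in> test_functions \<Omega>" "\<psi> \<in> test_functions \<Omega>"
  shows "grad (\<lambda>x. \<phi> x + \<psi> x) = (\<lambda>x. grad \<phi> x + grad \<psi> x)"
proof (intro ext)
  fix x
  have "(\<phi> has_derivative frechet_derivative \<phi> (at x)) (at x)"
    "(\<psi> has_derivative frechet_derivative \<psi> (at x)) (at x)"
    using assms[THEN test_function_differentiable] by (auto simp: frechet_derivative_works)
  from partial_deriv_has_derivative[OF has_derivative_add[OF this]]
  show "grad (\<lambda>x. \<phi> x + \<psi> x) x = grad \<phi> x + grad \<psi> x"
    by (simp add: grad_def vec_eq_iff partial_deriv_def)
qed

lemma grad_scale:
  assumes "\<phi> \<in> test_functions \<Omega>"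
  shows "grad (\<lambda>x. c * \<phi> x) = (\<lambda>x. c *\<^sub>R grad \<phi> x)"
proof (intro ext)
  fix x
  have "(\<phi> has_derivative frechet_derivative \<phi> (at x)) (at x)"
    using assms[THEN test_function_differentiable] by (auto simp: frechet_derivative_works)
  from partial_deriv_has_derivative[OF has_derivative_mult_right[OF this]]
  show "grad (\<lambda>x. c * \<phi> x) x = c *\<^sub>R grad \<phi> x"
    by (simp add: grad_def vec_eq_iff partial_deriv_def)
qed

lemma grad_diff:
  assumes "\<phi> \<in> test_functions \<Omega>" "\<psi> \<in> test_functions \<Omega>"
  shows "grad (\<lambda>x. \<phi> x - \<psi> x) = (\<lambda>x. grad \<phi> x - grad \<psi> x)"
  using grad_add[OF assms(1) test_functions_scale[OF assms(2), of "-1"]]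
    grad_scale[OF assms(2), of "-1"] by simp

lemma test_functions_diff:
  assumes "\<phi> \<in> test_functions \<Omega>" "\<psi> \<in> test_functions \<Omega>"
  shows "(\<lambda>x. \<phi> x - \<psi> x) \<in> test_functions \<Omega>"
  using test_functions_add[OF assms(1) test_functions_scale[OF assms(2), of "-1"]] by simp

lemma zero_test_function: "(\<lambda>_. 0) \<in> test_functions \<Omega>"
  by (rule test_functionsI[of _ "{}"]) (auto intro: C_k_const)

section \<open>Sobolev spaces on a bounded open set\<close>

locale bounded_domain =
  fixes \<Omega> :: "(real^'d::finite) set"
  assumes open_\<Omega>: "open \<Omega>" and bounded_\<Omega>: "bounded \<Omega>"
begin

abbreviation "L \<equiv> lebesgue_on \<Omega>"

text \<open>Boundedness makes the measure finite, so constants are square integrable and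
  \<open>L2_complete\<close> applies.\<close>

sublocale finite_measure L
  using lmeasurable_open[OF bounded_\<Omega> open_\<Omega>] by (rule finite_measure_lebesgue_on)

lemma L2_iff: "f \<in> L2 \<Omega> \<longleftrightarrow> square_integrable L f"
  by (simp add: L2_def square_integrable_def)

lemma square_integrable_compact_support:
  fixes f :: "real^'d \<Rightarrow> 'b::euclidean_space"
  assumes "continuous_on UNIV f" "compact C" "C \<subseteq> \<Omega>" "\<And>x. x \<notin> C \<Longrightarrow> f x = 0"
  shows "square_integrable L f"
proof -
  have "f \<in> borel_measurable L"
    using assms(1)
    by (intro measurable_restrict_space1 measurable_completion) (simp add: borel_measurable_continuous_onI)
  moreover have "integrable L (\<lambda>x. (norm (f x))\<^sup>2)"
    using assms open_\<Omega> by (intro lebesgue_on_compact_support(1)[of _ _ C] continuous_intros) auto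
  ultimately show ?thesis by (simp add: square_integrable_def)
qed

lemma square_integrable_test_function:
  assumes "\<phi> \<in> test_functions \<Omega>"
  shows "square_integrable L \<phi>" "square_integrable L (grad \<phi>)"
proof -
  obtain C where C: "compact C" "C \<subseteq> \<Omega>" "\<forall>x. x \<notin> C \<longrightarrow> \<phi> x = 0"
    using test_functionsE[OF assms] by blast
  show "square_integrable L \<phi>"
    using C test_function_continuous[OF assms] by (intro square_integrable_compact_support[of _ C]) auto
  have "continuous_on UNIV (grad \<phi>)"
    unfolding grad_def
    by (intro continuous_on_vec_lambda test_function_continuous[of _ \<Omega>] test_function_partial_deriv assms)
  moreover have "grad \<phi> x = 0" if "x \<notin> C" for x
    using that C by (simp add: grad_def vec_eq_iff partial_deriv_outside_support[of C] compact_imp_closed)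
  ultimately show "square_integrable L (grad \<phi>)"
    using C by (intro square_integrable_compact_support[of _ C]) auto
qed

lemma square_integrable_component:
  assumes "square_integrable L (g :: _ \<Rightarrow> real^'d)"
  shows "square_integrable L (\<lambda>x. g x $ j)"
proof -
  have m[measurable]: "(\<lambda>x. g x $ j) \<in> borel_measurable L"
    using assms borel_measurable_inner[of g L "\<lambda>_. axis j 1"]
    by (simp add: square_integrable_def inner_axis)
  have "integrable L (\<lambda>x. (norm (g x $ j))\<^sup>2)"
    by (rule Bochner_Integration.integrable_bound[of _ "\<lambda>x. (norm (g x))\<^sup>2"])
       (use assms in \<open>auto simp: square_integrable_def intro!: AE_I2 power_mono component_le_norm_cart abs_le_square_iff[THEN iffD1]\<close>)
  then show ?thesis using m by (simp add: square_integrable_def)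
qed

lemma is_weak_grad_grad:
  assumes "\<phi> \<in> test_functions \<Omega>"
  shows "is_weak_grad \<Omega> \<phi> (grad \<phi>)"
  unfolding is_weak_grad_def grad_def
  using integral_by_parts_test_functions[OF open_\<Omega>] assms by (auto simp: test_functions_def)

lemma weak_grad_unique:
  assumes g: "square_integrable L g" "is_weak_grad \<Omega> u g"
    and h: "square_integrable L h" "is_weak_grad \<Omega> u h"
  shows "AE x in L. g x = h x"
proof -
  have "AE x in L. g x $ j - h x $ j = 0" for j
  proof (rule fundamental_lemma_variations[OF open_\<Omega>])
    have gj: "square_integrable L (\<lambda>x. g x $ j)" and hj: "square_integrable L (\<lambda>x. h x $ j)"
      using g h square_integrable_component by auto
    from square_integrable_inner[OF square_integrable_diff[OF gj hj] square_integrable_const[of 1]]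
    show "integrable L (\<lambda>x. g x $ j - h x $ j)" by simp
    fix \<phi> assume \<phi>: "\<phi> \<in> test_functions \<Omega>"
    have "integrable L (\<lambda>x. g x $ j * \<phi> x)" "integrable L (\<lambda>x. h x $ j * \<phi> x)"
      using square_integrable_inner[OF gj square_integrable_test_function(1)[OF \<phi>]]
        square_integrable_inner[OF hj square_integrable_test_function(1)[OF \<phi>]] by simp_all
    moreover have "(LINT x|L. g x $ j * \<phi> x) = (LINT x|L. h x $ j * \<phi> x)"
      using g(2)[unfolded is_weak_grad_def, rule_format, OF \<phi>, of j]
        h(2)[unfolded is_weak_grad_def, rule_format, OF \<phi>, of j] by simp
    ultimately show "(LINT x|L. (g x $ j - h x $ j) * \<phi> x) = 0"
      by (simp add: left_diff_distrib)
  qed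
  then have "AE x in L. \<forall>j. g x $ j - h x $ j = 0"
    by (simp add: AE_all_countable)
  then show ?thesis by eventually_elim (simp add: vec_eq_iff)
qed

lemma is_weak_grad_add:
  assumes "square_integrable L u" "square_integrable L g" "is_weak_grad \<Omega> u g"
    "square_integrable L v" "square_integrable L h" "is_weak_grad \<Omega> v h"
  shows "is_weak_grad \<Omega> (\<lambda>x. u x + v x) (\<lambda>x. g x + h x)"
  unfolding is_weak_grad_def
proof (intro ballI allI)
  fix \<phi> j assume \<phi>: "\<phi> \<in> test_functions \<Omega>"
  have d: "square_integrable L (partial_deriv j \<phi>)" and p: "square_integrable L \<phi>"
    using square_integrable_test_function(1) \<phi> test_function_partial_deriv by blast+
  have i: "integrable L (\<lambda>x. u x * partial_deriv j \<phi> x)" "integrable L (\<lambda>x. v x * partial_deriv j \<phi> x)"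
    "integrable L (\<lambda>x. g x $ j * \<phi> x)" "integrable L (\<lambda>x. h x $ j * \<phi> x)"
    using square_integrable_inner[OF assms(1) d] square_integrable_inner[OF assms(4) d]
      square_integrable_inner[OF square_integrable_component[OF assms(2)] p]
      square_integrable_inner[OF square_integrable_component[OF assms(5)] p] by auto
  then show "(LINT x|L. (u x + v x) * partial_deriv j \<phi> x) = - (LINT x|L. (g x + h x) $ j * \<phi> x)"
    using assms(3,6) \<phi> unfolding is_weak_grad_def by (simp add: distrib_right)
qed

lemma is_weak_grad_scale:
  "is_weak_grad \<Omega> u g \<Longrightarrow> is_weak_grad \<Omega> (\<lambda>x. c * u x) (\<lambda>x. c *\<^sub>R g x)"
  by (simp add: is_weak_grad_def mult.assoc)

lemma is_weak_grad_lim: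
  assumes u: "L2_lim L U u" and g: "L2_lim L G g" and UG: "\<And>n. is_weak_grad \<Omega> (U n) (G n)"
  shows "is_weak_grad \<Omega> u g"
  unfolding is_weak_grad_def
proof (intro ballI allI)
  fix \<phi> j assume \<phi>: "\<phi> \<in> test_functions \<Omega>"
  have d: "square_integrable L (partial_deriv j \<phi>)" and p: "square_integrable L \<phi>"
    using square_integrable_test_function(1) \<phi> test_function_partial_deriv by blast+
  \<comment> \<open>Multiplying by the basis vector turns the component integral into an inner
    product of vector fields, as \<open>L2_lim_inner\<close> expects.\<close>
  have "(\<lambda>x. \<phi> x *\<^sub>R (axis j 1 :: real^'d)) \<in> borel_measurable L"
    using p by (auto simp: square_integrable_def intro!: borel_measurable_scaleR)
  then have pj: "square_integrable L (\<lambda>x. \<phi> x *\<^sub>R (axis j 1 :: real^'d))"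
    using p by (simp add: square_integrable_def norm_axis_1)
  have "(\<lambda>n. LINT x|L. U n x * partial_deriv j \<phi> x) \<longlonglongrightarrow> (LINT x|L. u x * partial_deriv j \<phi> x)"
    using L2_lim_inner[OF u d] by simp
  moreover have "(\<lambda>n. - (LINT x|L. G n x $ j * \<phi> x)) \<longlonglongrightarrow> - (LINT x|L. g x $ j * \<phi> x)"
    using L2_lim_inner[OF g pj] by (intro tendsto_minus) (simp add: inner_axis mult.commute)
  moreover have "(LINT x|L. U n x * partial_deriv j \<phi> x) = - (LINT x|L. G n x $ j * \<phi> x)" for n
    using UG \<phi> by (simp add: is_weak_grad_def)
  ultimately show "(LINT x|L. u x * partial_deriv j \<phi> x) = - (LINT x|L. g x $ j * \<phi> x)"
    by (simp add: LIMSEQ_unique)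
qed

lemma H1_wgrad:
  assumes "u \<in> H1 \<Omega>"
  shows "square_integrable L u" "square_integrable L (wgrad \<Omega> u)" "is_weak_grad \<Omega> u (wgrad \<Omega> u)"
proof -
  have "\<exists>g. g \<in> L2 \<Omega> \<and> is_weak_grad \<Omega> u g" using assms by (auto simp: H1_def)
  from someI_ex[OF this]
  show "square_integrable L (wgrad \<Omega> u)" "is_weak_grad \<Omega> u (wgrad \<Omega> u)"
    by (auto simp: wgrad_def L2_iff)
  show "square_integrable L u" using assms by (auto simp: H1_def L2_iff)
qed

lemma H1_I: "square_integrable L u \<Longrightarrow> square_integrable L g \<Longrightarrow> is_weak_grad \<Omega> u g \<Longrightarrow> u \<in> H1 \<Omega>"
  by (auto simp: H1_def L2_iff)

lemma wgrad_AE_eq: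
  assumes "square_integrable L u" "square_integrable L g" "is_weak_grad \<Omega> u g"
  shows "AE x in L. wgrad \<Omega> u x = g x"
  using weak_grad_unique[OF H1_wgrad(2,3)[OF H1_I[OF assms]] assms(2,3)] .

text \<open>Frees the norm from the choice inside \<open>wgrad\<close>: by uniqueness any square
  integrable weak gradient computes it.\<close>

lemma H1_norm_eq:
  assumes "square_integrable L u" "square_integrable L g" "is_weak_grad \<Omega> u g"
  shows "H1_norm \<Omega> u = sqrt ((LINT x|L. (norm (u x))\<^sup>2) + (LINT x|L. (norm (g x))\<^sup>2))"
proof -
  have "(LINT x|L. (norm (wgrad \<Omega> u x))\<^sup>2) = (LINT x|L. (norm (g x))\<^sup>2)"
    using wgrad_AE_eq[OF assms] H1_wgrad(2)[OF H1_I[OF assms]] assms(2)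
    by (intro integral_cong_AE) (auto simp: square_integrable_def)
  then show ?thesis by (simp add: H1_norm_def)
qed

lemma H1_norm_diff_tendsto_0_iff:
  assumes U: "\<And>n. square_integrable L (U n)" "\<And>n. square_integrable L (G n)" "\<And>n. is_weak_grad \<Omega> (U n) (G n)"
    and u: "square_integrable L u" "square_integrable L g" "is_weak_grad \<Omega> u g"
  shows "(\<lambda>n. H1_norm \<Omega> (\<lambda>x. U n x - u x)) \<longlonglongrightarrow> 0 \<longleftrightarrow> L2_lim L U u \<and> L2_lim L G g"
proof -
  let ?a = "\<lambda>n. LINT x|L. (norm (U n x - u x))\<^sup>2" and ?b = "\<lambda>n. LINT x|L. (norm (G n x - g x))\<^sup>2"
  have "is_weak_grad \<Omega> (\<lambda>x. U n x - u x) (\<lambda>x. G n x - g x)" for n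
    using is_weak_grad_add[OF U[of n] square_integrable_scale[OF u(1), of "-1"]
        square_integrable_scale[OF u(2), of "-1"]] is_weak_grad_scale[OF u(3), of "-1"] by simp
  then have "H1_norm \<Omega> (\<lambda>x. U n x - u x) = sqrt (?a n + ?b n)" for n
    using U u by (intro H1_norm_eq) (auto intro: square_integrable_diff)
  then have "(\<lambda>n. H1_norm \<Omega> (\<lambda>x. U n x - u x)) \<longlonglongrightarrow> 0 \<longleftrightarrow> (\<lambda>n. sqrt (?a n + ?b n)) \<longlonglongrightarrow> 0"
    by simp
  also have "\<dots> \<longleftrightarrow> (\<lambda>n. ?a n + ?b n) \<longlonglongrightarrow> 0"
  proof
    assume "(\<lambda>n. sqrt (?a n + ?b n)) \<longlonglongrightarrow> 0"
    then have "(\<lambda>n. (sqrt (?a n + ?b n))\<^sup>2) \<longlonglongrightarrow> 0\<^sup>2" by (intro tendsto_intros)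
    then show "(\<lambda>n. ?a n + ?b n) \<longlonglongrightarrow> 0" by simp
  next
    assume "(\<lambda>n. ?a n + ?b n) \<longlonglongrightarrow> 0"
    then show "(\<lambda>n. sqrt (?a n + ?b n)) \<longlonglongrightarrow> 0" using tendsto_real_sqrt by fastforce
  qed
  also have "\<dots> \<longleftrightarrow> ?a \<longlonglongrightarrow> 0 \<and> ?b \<longlonglongrightarrow> 0"
  proof
    assume *: "(\<lambda>n. ?a n + ?b n) \<longlonglongrightarrow> 0"
    have "?a \<longlonglongrightarrow> 0" by (rule tendsto_sandwich[OF _ _ tendsto_const *]) auto
    moreover have "?b \<longlonglongrightarrow> 0" by (rule tendsto_sandwich[OF _ _ tendsto_const *]) auto
    ultimately show "?a \<longlonglongrightarrow> 0 \<and> ?b \<longlonglongrightarrow> 0" ..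
  next
    assume "?a \<longlonglongrightarrow> 0 \<and> ?b \<longlonglongrightarrow> 0"
    then have "(\<lambda>n. ?a n + ?b n) \<longlonglongrightarrow> 0 + 0" by (intro tendsto_add) auto
    then show "(\<lambda>n. ?a n + ?b n) \<longlonglongrightarrow> 0" by simp
  qed
  finally show ?thesis using U u by (simp add: L2_lim_def)
qed

text \<open>\<open>is_weak_grad_lim\<close> shows that the limit \<open>g\<close> of the gradients
  is automatically a weak gradient of \<open>u\<close>. The characterisation thus avoids
  \<open>wgrad\<close>, and closure under sums and multiples reduces to limits of test
  functions.\<close>

lemma H10_iff:
  "u \<in> H10 \<Omega> \<longleftrightarrow> (\<exists>\<phi> g. (\<forall>n. \<phi> n \<in> test_functions \<Omega>) \<and> L2_lim L \<phi> u \<and> L2_lim L (\<lambda>n. grad (\<phi> n)) g)"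
    (is "_ \<longleftrightarrow> ?rhs")
proof
  assume u: "u \<in> H10 \<Omega>"
  then obtain \<phi> where \<phi>: "\<And>n::nat. \<phi> n \<in> test_functions \<Omega>"
      "(\<lambda>n. H1_norm \<Omega> (\<lambda>x. \<phi> n x - u x)) \<longlonglongrightarrow> 0"
    by (auto simp: H10_def)
  have u1: "u \<in> H1 \<Omega>" using u by (simp add: H10_def)
  have "L2_lim L \<phi> u \<and> L2_lim L (\<lambda>n. grad (\<phi> n)) (wgrad \<Omega> u)"
    using H1_norm_diff_tendsto_0_iff[OF square_integrable_test_function[OF \<phi>(1)] is_weak_grad_grad[OF \<phi>(1)]
        H1_wgrad[OF u1]] \<phi>(2) by simp
  then show ?rhs using \<phi>(1) by blast
next
  assume ?rhs
  then obtain \<phi> g where \<phi>: "\<And>n. \<phi> n \<in> test_functions \<Omega>" "L2_lim L \<phi> u" "L2_lim L (\<lambda>n. grad (\<phi> n)) g"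
    by blast
  have g: "is_weak_grad \<Omega> u g"
    by (rule is_weak_grad_lim[OF \<phi>(2,3) is_weak_grad_grad[OF \<phi>(1)]])
  have sq: "square_integrable L u" "square_integrable L g" using \<phi> by (auto simp: L2_lim_def)
  have "(\<lambda>n. H1_norm \<Omega> (\<lambda>x. \<phi> n x - u x)) \<longlonglongrightarrow> 0"
    using H1_norm_diff_tendsto_0_iff[OF square_integrable_test_function[OF \<phi>(1)] is_weak_grad_grad[OF \<phi>(1)]
        sq g] \<phi> by simp
  then show "u \<in> H10 \<Omega>" using \<phi>(1) H1_I[OF sq g] by (auto simp: H10_def)
qed

lemma H10_add:
  assumes "u \<in> H10 \<Omega>" "v \<in> H10 \<Omega>"
  shows "(\<lambda>x. u x + v x) \<in> H10 \<Omega>"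
proof -
  obtain \<phi> g where \<phi>: "\<And>n. \<phi> n \<in> test_functions \<Omega>" "L2_lim L \<phi> u" "L2_lim L (\<lambda>n. grad (\<phi> n)) g"
    using assms(1) unfolding H10_iff by blast
  obtain \<psi> h where \<psi>: "\<And>n. \<psi> n \<in> test_functions \<Omega>" "L2_lim L \<psi> v" "L2_lim L (\<lambda>n. grad (\<psi> n)) h"
    using assms(2) unfolding H10_iff by blast
  have "L2_lim L (\<lambda>n. grad (\<lambda>x. \<phi> n x + \<psi> n x)) (\<lambda>x. g x + h x)"
    using L2_lim_add[OF \<phi>(3) \<psi>(3)] by (simp add: grad_add[OF \<phi>(1) \<psi>(1)])
  then show ?thesis
    unfolding H10_iff using L2_lim_add[OF \<phi>(2) \<psi>(2)] test_functions_add[OF \<phi>(1) \<psi>(1)]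
    by (intro exI[of _ "\<lambda>n x. \<phi> n x + \<psi> n x"] exI[of _ "\<lambda>x. g x + h x"]) simp
qed

lemma H10_scale:
  assumes "u \<in> H10 \<Omega>"
  shows "(\<lambda>x. c * u x) \<in> H10 \<Omega>"
proof -
  obtain \<phi> g where \<phi>: "\<And>n. \<phi> n \<in> test_functions \<Omega>" "L2_lim L \<phi> u" "L2_lim L (\<lambda>n. grad (\<phi> n)) g"
    using assms unfolding H10_iff by blast
  have "L2_lim L (\<lambda>n. grad (\<lambda>x. c * \<phi> n x)) (\<lambda>x. c *\<^sub>R g x)"
    using L2_lim_scale[OF \<phi>(3)] by (simp add: grad_scale[OF \<phi>(1)])
  moreover have "L2_lim L (\<lambda>n x. c * \<phi> n x) (\<lambda>x. c * u x)"
    using L2_lim_scale[OF \<phi>(2)] by simp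
  ultimately show ?thesis
    unfolding H10_iff using test_functions_scale[OF \<phi>(1)]
    by (intro exI[of _ "\<lambda>n x. c * \<phi> n x"] exI[of _ "\<lambda>x. c *\<^sub>R g x"]) simp
qed

lemma test_function_H10:
  assumes "\<phi> \<in> test_functions \<Omega>"
  shows "\<phi> \<in> H10 \<Omega>"
  unfolding H10_iff using assms square_integrable_test_function[OF assms]
  by (intro exI[of _ "\<lambda>_. \<phi>"] exI[of _ "grad \<phi>"]) (simp add: L2_lim_const)

end

section \<open>Existence of weak solutions\<close>

text \<open>
  A minimising sequence of \<open>B v v - 2 * F v\<close> is Cauchy and satisfies the Euler-Lagrange
  equation in the limit.
\<close>

lemma riesz_sequence:
  fixes V :: "('a \<Rightarrow> real) set" and B :: "('a \<Rightarrow> real) \<Rightarrow> ('a \<Rightarrow> real) \<Rightarrow> real"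
  assumes zero: "(\<lambda>_. 0) \<in> V"
    and add: "\<And>u v. u \<in> V \<Longrightarrow> v \<in> V \<Longrightarrow> (\<lambda>x. u x + v x) \<in> V"
    and scale: "\<And>c u. u \<in> V \<Longrightarrow> (\<lambda>x. c * u x) \<in> V"
    and B_sym: "\<And>u v. u \<in> V \<Longrightarrow> v \<in> V \<Longrightarrow> B u v = B v u"
    and B_add: "\<And>u v w. u \<in> V \<Longrightarrow> v \<in> V \<Longrightarrow> w \<in> V \<Longrightarrow> B (\<lambda>x. u x + v x) w = B u w + B v w"
    and B_scale: "\<And>c u w. u \<in> V \<Longrightarrow> w \<in> V \<Longrightarrow> B (\<lambda>x. c * u x) w = c * B u w"
    and B_nonneg: "\<And>u. u \<in> V \<Longrightarrow> 0 \<le> B u u"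
    and F_add: "\<And>u v. u \<in> V \<Longrightarrow> v \<in> V \<Longrightarrow> F (\<lambda>x. u x + v x) = F u + F v"
    and F_scale: "\<And>c u. u \<in> V \<Longrightarrow> F (\<lambda>x. c * u x) = c * F u"
    and F_bound: "\<And>u. u \<in> V \<Longrightarrow> (F u)\<^sup>2 \<le> C * B u u" and "0 \<le> C"
  shows "\<exists>\<phi>. (\<forall>n. \<phi> n \<in> V) \<and>
    (\<forall>e>0. \<exists>N::nat. \<forall>m\<ge>N. \<forall>n\<ge>N. B (\<lambda>x. \<phi> m x - \<phi> n x) (\<lambda>x. \<phi> m x - \<phi> n x) < e) \<and>
    (\<forall>\<psi>\<in>V. (\<lambda>n. B (\<phi> n) \<psi>) \<longlonglongrightarrow> F \<psi>)"
proof -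
  define J where "J v = B v v - 2 * F v" for v
  define m where "m = Inf (J ` V)"
  define \<epsilon> where "\<epsilon> n = inverse (real (Suc n))" for n
  \<comment> \<open>By the bound on \<open>F\<close> and the arithmetic-geometric mean inequality, 2
    F v is at most C + B v v.\<close>
  have J_bound: "- C \<le> J v" if "v \<in> V" for v
  proof -
    have "(2 * F v)\<^sup>2 \<le> 4 * (C * B v v)" using F_bound[OF that] by (simp add: power_mult_distrib)
    also have "\<dots> \<le> (C + B v v)\<^sup>2"
      using sum_squares_bound[of C "B v v"] by (simp add: power2_sum algebra_simps)
    finally have "2 * F v \<le> C + B v v"
      by (rule power2_le_imp_le) (use \<open>0 \<le> C\<close> B_nonneg[OF that] in auto)
    then show ?thesis by (simp add: J_def)
  qed
  then have bdd: "bdd_below (J ` V)" by (intro bdd_belowI2[of V "- C" J])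
  have m_le: "m \<le> J v" if "v \<in> V" for v
    unfolding m_def using bdd that by (rule cINF_lower)
  have "\<exists>v\<in>V. J v < m + \<epsilon> n" for n
    using cInf_lessD[of "J ` V" "m + \<epsilon> n"] zero by (auto simp: m_def \<epsilon>_def)
  then obtain \<phi> where \<phi>: "\<And>n. \<phi> n \<in> V" "\<And>n. J (\<phi> n) < m + \<epsilon> n" by metis
  have J_expand: "J (\<lambda>x. u x + t * v x) = J u + 2 * t * (B u v - F v) + t\<^sup>2 * B v v"
    if uv: "u \<in> V" "v \<in> V" for u v t
  proof -
    have tv: "(\<lambda>x. t * v x) \<in> V" using uv scale by blast
    note w = add[OF uv(1) tv]
    have "B (\<lambda>x. u x + t * v x) (\<lambda>x. u x + t * v x) =
        B u (\<lambda>x. u x + t * v x) + t * B v (\<lambda>x. u x + t * v x)"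
      using uv tv w by (simp add: B_add[OF uv(1) tv] B_scale)
    moreover have "B z (\<lambda>x. u x + t * v x) = B z u + t * B z v" if "z \<in> V" for z
      using uv tv w that B_sym[of z] B_add[OF uv(1) tv that] B_scale[OF uv(2) that, of t] by simp
    moreover have "F (\<lambda>x. u x + t * v x) = F u + t * F v"
      using F_add[OF uv(1) tv] F_scale[OF uv(2), of t] by simp
    ultimately show ?thesis
      using uv B_sym[of v u] by (simp add: J_def power2_eq_square algebra_simps)
  qed
  \<comment> \<open>The competitor \<open>\<phi> n + t * \<psi>\<close> cannot undercut the infimum,
    while \<open>\<phi> n\<close> is within \<open>\<epsilon> n\<close> of it. The discriminant of
    this quadratic in \<open>t\<close> bounds the residual of the Euler-Lagrange equation.\<close>
  have quad: "0 \<le> \<epsilon> n + 2 * t * (B (\<phi> n) \<psi> - F \<psi>) + t\<^sup>2 * B \<psi> \<psi>" if "\<psi> \<in> V" for n t \<psi>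
    using m_le[OF add[OF \<phi>(1)[of n] scale[OF that, of t]]] \<phi>(2)[of n] J_expand[OF \<phi>(1)[of n] that, of t]
    by simp
  have \<epsilon>_lim: "\<epsilon> \<longlonglongrightarrow> 0" unfolding \<epsilon>_def by (rule LIMSEQ_inverse_real_of_nat)
  have "(\<lambda>n. B (\<phi> n) \<psi>) \<longlonglongrightarrow> F \<psi>" if "\<psi> \<in> V" for \<psi>
  proof -
    have le: "(B (\<phi> n) \<psi> - F \<psi>)\<^sup>2 \<le> \<epsilon> n * B \<psi> \<psi>" for n
      using quad[OF that] B_nonneg[OF that] by (rule quadratic_nonneg_imp_discriminant_le)
    have lim: "(\<lambda>n. \<epsilon> n * B \<psi> \<psi>) \<longlonglongrightarrow> 0" by (rule tendsto_mult_left_zero[OF \<epsilon>_lim])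
    have "(\<lambda>n. (B (\<phi> n) \<psi> - F \<psi>)\<^sup>2) \<longlonglongrightarrow> 0"
      by (rule tendsto_sandwich[OF always_eventually always_eventually tendsto_const lim]) (use le in simp_all)
    then show ?thesis by (simp add: LIM_zero_iff)
  qed
  moreover have "\<exists>N. \<forall>k\<ge>N. \<forall>n\<ge>N. B (\<lambda>x. \<phi> k x - \<phi> n x) (\<lambda>x. \<phi> k x - \<phi> n x) < e" if "0 < e" for e
  proof -
    \<comment> \<open>The estimate below yields S < 2 * \<open>\<epsilon> k\<close> + 4 *
      \<open>\<epsilon> n\<close>, hence the factor 6.\<close>
    have "eventually (\<lambda>n. \<epsilon> n < e / 6) sequentially"
      using \<epsilon>_lim that by (intro order_tendstoD(2)) auto
    then obtain N where N: "\<And>n. N \<le> n \<Longrightarrow> \<epsilon> n < e / 6" by (auto simp: eventually_sequentially)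
    have "B (\<lambda>x. \<phi> k x - \<phi> n x) (\<lambda>x. \<phi> k x - \<phi> n x) < e" if "N \<le> k" "N \<le> n" for k n
    proof -
      let ?d = "\<lambda>x. \<phi> k x - \<phi> n x"
      have d: "?d \<in> V" using add[OF \<phi>(1)[of k] scale[OF \<phi>(1)[of n], of "-1"]] by simp
      define S b where "S = B ?d ?d" and "b = B (\<phi> n) ?d - F ?d"
      have "J (\<phi> k) = J (\<phi> n) + 2 * b + S"
        unfolding S_def b_def using J_expand[OF \<phi>(1)[of n] d, of 1] by simp
      \<comment> \<open>The competitor is the midpoint of \<open>\<phi> n\<close> and
        \<open>\<phi> k\<close>, as in the parallelogram argument; it bounds \<open>b\<close> below,
        while near-minimality of \<open>\<phi> k\<close> bounds 2 b + S above.\<close>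
      moreover have "0 \<le> \<epsilon> n + b + S / 4"
        unfolding S_def b_def using quad[OF d, of n "1/2"] by (simp add: power2_eq_square)
      ultimately have "S < e"
        using m_le[OF \<phi>(1)[of n]] \<phi>(2)[of k] N[OF that(1)] N[OF that(2)]
        by (simp add: field_simps)
      then show ?thesis by (simp add: S_def)
    qed
    then show ?thesis by blast
  qed
  ultimately show ?thesis using \<phi>(1) by blast
qed

lemma square_integrable_bounded_scale:
  fixes f :: "'a \<Rightarrow> 'b::euclidean_space"
  assumes f: "square_integrable M f" and a: "a \<in> borel_measurable M" "AE x in M. \<bar>a x\<bar> \<le> c"
  shows "square_integrable M (\<lambda>x. a x *\<^sub>R f x)"
proof -
  have m: "(\<lambda>x. a x *\<^sub>R f x) \<in> borel_measurable M"
    using assms by (auto simp: square_integrable_def)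
  have "integrable M (\<lambda>x. (norm (a x *\<^sub>R f x))\<^sup>2)"
  proof (rule Bochner_Integration.integrable_bound)
    show "integrable M (\<lambda>x. c\<^sup>2 * (norm (f x))\<^sup>2)" using f by (simp add: square_integrable_def)
    show "(\<lambda>x. (norm (a x *\<^sub>R f x))\<^sup>2) \<in> borel_measurable M"
      using m[measurable] by measurable
    show "AE x in M. norm ((norm (a x *\<^sub>R f x))\<^sup>2) \<le> norm (c\<^sup>2 * (norm (f x))\<^sup>2)"
      using a(2)
    proof eventually_elim
      case (elim x)
      then have "\<bar>a x\<bar>\<^sup>2 \<le> c\<^sup>2" by (intro power_mono) auto
      then show ?case by (simp add: power_mult_distrib mult_right_mono)
    qed
  qed
  then show ?thesis using m by (simp add: square_integrable_def)
qed

context bounded_domain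
begin

text \<open>Integrate \<open>\<phi>\<^sup>2\<close> by parts against the coordinate function \<open>x $ j\<close>.\<close>

lemma Poincare_inequality:
  "\<exists>C\<ge>0. \<forall>\<phi>\<in>test_functions \<Omega>.
     (LINT x|L. (norm (\<phi> x))\<^sup>2) \<le> C * (LINT x|L. (norm (grad \<phi> x))\<^sup>2)"
proof -
  obtain R where R: "0 < R" "\<And>x. x \<in> \<Omega> \<Longrightarrow> norm x \<le> R"
    using bounded_\<Omega> by (auto simp: bounded_pos)
  have "(LINT x|L. (norm (\<phi> x))\<^sup>2) \<le> (4 * R\<^sup>2) * (LINT x|L. (norm (grad \<phi> x))\<^sup>2)"
    if \<phi>: "\<phi> \<in> test_functions \<Omega>" for \<phi>
  proof -
    \<comment> \<open>Any one coordinate suffices, and the index type is nonempty.\<close>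
    fix j :: 'd
    let ?A = "LINT x|L. (norm (\<phi> x))\<^sup>2" and ?G = "LINT x|L. (norm (grad \<phi> x))\<^sup>2"
    define g where "g x = x $ j * partial_deriv j \<phi> x" for x
    have gt: "g \<in> test_functions \<Omega>"
      unfolding g_def using \<phi>
      by (intro test_functions_mult test_function_partial_deriv C_k_component)
    have C\<phi>: "C_k k \<phi>" for k using \<phi> by (simp add: test_functions_def)
    have "partial_deriv j (\<lambda>x. x $ j) = (\<lambda>x::real^'d. 1)"
      by (rule ext, subst partial_deriv_has_derivative[OF bounded_linear_imp_has_derivative[OF bounded_linear_vec_nth]]) simp
    then have "(LINT x|L. x $ j * partial_deriv j (\<lambda>x. \<phi> x * \<phi> x) x) = - (LINT x|L. \<phi> x * \<phi> x)"
      using integral_by_parts_test_functions[OF open_\<Omega> C_k_component test_functions_mult[OF C\<phi> \<phi>], of j j]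
      by simp
    moreover have "(LINT x|L. x $ j * partial_deriv j (\<lambda>x. \<phi> x * \<phi> x) x) = (LINT x|L. 2 * (\<phi> x \<bullet> g x))"
      using test_function_differentiable[OF \<phi>]
      by (simp add: partial_deriv_mult g_def algebra_simps)
    ultimately have A: "?A = - 2 * (LINT x|L. \<phi> x \<bullet> g x)"
      by (simp add: power2_eq_square)
    have "?A\<^sup>2 \<le> 4 * (?A * (LINT x|L. (norm (g x))\<^sup>2))"
      unfolding A[THEN arg_cong[where f = power2]]
      using integral_Cauchy_Schwarz[OF square_integrable_test_function(1)[OF \<phi>] square_integrable_test_function(1)[OF gt]]
      by (simp add: power_mult_distrib)
    moreover have "(LINT x|L. (norm (g x))\<^sup>2) \<le> R\<^sup>2 * ?G"
    proof -
      have "(norm (g x))\<^sup>2 \<le> R\<^sup>2 * (norm (grad \<phi> x))\<^sup>2" if "x \<in> \<Omega>" for x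
      proof -
        have "\<bar>x $ j\<bar> \<le> R" using R(2)[OF that] component_le_norm_cart[of x j] by linarith
        moreover have "\<bar>partial_deriv j \<phi> x\<bar> \<le> norm (grad \<phi> x)"
          using component_le_norm_cart[of "grad \<phi> x" j] by (simp add: grad_def)
        ultimately have "norm (g x) \<le> R * norm (grad \<phi> x)"
          unfolding g_def using R(1) by (auto simp: abs_mult intro!: mult_mono)
        then have "(norm (g x))\<^sup>2 \<le> (R * norm (grad \<phi> x))\<^sup>2" by (intro power_mono) auto
        then show ?thesis by (simp add: power_mult_distrib)
      qed
      then have "(LINT x|L. (norm (g x))\<^sup>2) \<le> (LINT x|L. R\<^sup>2 * (norm (grad \<phi> x))\<^sup>2)"
        using square_integrable_test_function(1)[OF gt] square_integrable_test_function(2)[OF \<phi>]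
        by (intro integral_mono) (auto simp: square_integrable_def)
      then show ?thesis by simp
    qed
    ultimately have "?A\<^sup>2 \<le> 4 * (?A * (R\<^sup>2 * ?G))"
      by (smt (verit) mult_left_mono Bochner_Integration.integral_nonneg zero_le_power2)
    then have "?A * ?A \<le> ?A * (4 * R\<^sup>2 * ?G)" by (simp add: power2_eq_square algebra_simps)
    moreover have "0 \<le> ?A" "0 \<le> ?G" by simp_all
    \<comment> \<open>Cancelling one factor \<open>?A\<close> leaves the constant 4 R^2; the case
      \<open>?A = 0\<close> is separate because it forbids the cancellation.\<close>
    ultimately show ?thesis
      by (cases "?A = 0") (simp, metis mult_le_cancel_left_pos order_le_less)
  qed
  then show ?thesis by (intro exI[of _ "4 * R\<^sup>2"]) auto
qed

text \<open>The lower bound \<open>c1\<close> turns Cauchy in energy into Cauchy in L2 for the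
  gradients, and the Poincare inequality adds the functions themselves. The limits form a member of
  \<open>H10\<close>; the equation, known against test functions, extends by density.\<close>

lemma weak_solution_exists:
  assumes a: "a \<in> borel_measurable L" "AE x in L. c1 \<le> a x \<and> a x \<le> c2" "0 < c1"
    and F: "F \<in> H_minus1 \<Omega>"
  shows "\<exists>u. weak_solution \<Omega> a F u"
proof -
  define B where "B \<phi> \<psi> = (LINT x|L. grad \<phi> x \<bullet> (a x *\<^sub>R grad \<psi> x))" for \<phi> \<psi>
  let ?V = "test_functions \<Omega>"
  note sq = square_integrable_test_function
  have F_add: "\<And>u v. u \<in> H10 \<Omega> \<Longrightarrow> v \<in> H10 \<Omega> \<Longrightarrow> F (\<lambda>x. u x + v x) = F u + F v"
    and F_scale: "\<And>c u. u \<in> H10 \<Omega> \<Longrightarrow> F (\<lambda>x. c * u x) = c * F u"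
    using F by (auto simp: H_minus1_def)
  obtain C where C: "\<forall>u\<in>H10 \<Omega>. \<bar>F u\<bar> \<le> C * H1_norm \<Omega> u"
    using F by (auto simp: H_minus1_def)
  obtain P where P: "0 \<le> P" "\<And>\<phi>. \<phi> \<in> ?V \<Longrightarrow> (LINT x|L. (norm (\<phi> x))\<^sup>2) \<le> P * (LINT x|L. (norm (grad \<phi> x))\<^sup>2)"
    using Poincare_inequality by blast
  have ab: "AE x in L. \<bar>a x\<bar> \<le> c2" using a(2,3) by auto
  have asq: "square_integrable L (\<lambda>x. a x *\<^sub>R g x)" if "square_integrable L g" for g :: "real^'d \<Rightarrow> real^'d"
    using square_integrable_bounded_scale[OF that a(1) ab] .
  have iB: "integrable L (\<lambda>x. grad \<phi> x \<bullet> (a x *\<^sub>R grad \<psi> x))" if "\<phi> \<in> ?V" "\<psi> \<in> ?V" for \<phi> \<psi>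
    using that by (intro square_integrable_inner asq sq)
  have coercive: "c1 * (LINT x|L. (norm (grad \<phi> x))\<^sup>2) \<le> B \<phi> \<phi>" if "\<phi> \<in> ?V" for \<phi>
  proof -
    have "(LINT x|L. c1 * (norm (grad \<phi> x))\<^sup>2) \<le> (LINT x|L. grad \<phi> x \<bullet> (a x *\<^sub>R grad \<phi> x))"
    proof (rule integral_mono_AE)
      show "AE x in L. c1 * (norm (grad \<phi> x))\<^sup>2 \<le> grad \<phi> x \<bullet> (a x *\<^sub>R grad \<phi> x)"
        using a(2) by eventually_elim (simp add: power2_norm_eq_inner mult_right_mono)
    qed (use sq[OF that] iB[OF that that] in \<open>auto simp: square_integrable_def\<close>)
    then show ?thesis by (simp add: B_def)
  qed
  \<comment> \<open>Poincare bounds the squared H1 norm by P + 1 times the squared gradient norm,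
    and coercivity converts the latter to energy at the price of 1 / \<open>c1\<close>.\<close>
  have F_bound: "(F \<phi>)\<^sup>2 \<le> (C\<^sup>2 * (P + 1) / c1) * B \<phi> \<phi>" if \<phi>: "\<phi> \<in> ?V" for \<phi>
  proof -
    let ?G = "LINT x|L. (norm (grad \<phi> x))\<^sup>2"
    have "\<bar>F \<phi>\<bar>\<^sup>2 \<le> (C * H1_norm \<Omega> \<phi>)\<^sup>2"
      using C[rule_format, OF test_function_H10[OF \<phi>]] by (intro power_mono) auto
    also have "\<dots> = C\<^sup>2 * ((LINT x|L. (norm (\<phi> x))\<^sup>2) + ?G)"
      unfolding H1_norm_eq[OF sq[OF \<phi>] is_weak_grad_grad[OF \<phi>]]
      by (simp add: power_mult_distrib)
    also have "\<dots> \<le> C\<^sup>2 * ((P + 1) * ?G)"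
      using P(2)[OF \<phi>] by (intro mult_left_mono) (auto simp: algebra_simps)
    also have "\<dots> = (C\<^sup>2 * (P + 1) / c1) * (c1 * ?G)" using a(3) by simp
    also have "\<dots> \<le> (C\<^sup>2 * (P + 1) / c1) * B \<phi> \<phi>"
      using coercive[OF \<phi>] P(1) a(3) by (intro mult_left_mono) auto
    finally show ?thesis by simp
  qed
  have B_nonneg: "0 \<le> B \<phi> \<phi>" if "\<phi> \<in> ?V" for \<phi>
    using coercive[OF that] a(3) by (smt (verit) Bochner_Integration.integral_nonneg mult_nonneg_nonneg zero_le_power2)
  have B_sym: "B \<phi> \<psi> = B \<psi> \<phi>" for \<phi> \<psi> by (simp add: B_def inner_commute)
  have B_add: "B (\<lambda>x. \<phi> x + \<psi> x) \<rho> = B \<phi> \<rho> + B \<psi> \<rho>" if "\<phi> \<in> ?V" "\<psi> \<in> ?V" "\<rho> \<in> ?V" for \<phi> \<psi> \<rho>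
    using iB[OF that(1,3)] iB[OF that(2,3)] by (simp add: B_def grad_add[OF that(1,2)] inner_add_left distrib_left)
  have B_scale: "B (\<lambda>x. c * \<phi> x) \<rho> = c * B \<phi> \<rho>" if "\<phi> \<in> ?V" "\<rho> \<in> ?V" for c \<phi> \<rho>
    unfolding B_def grad_scale[OF that(1)] inner_scaleR_left by simp
  have C0: "0 \<le> C\<^sup>2 * (P + 1) / c1" using P(1) a(3) by simp
  have "\<exists>\<phi>. (\<forall>n. \<phi> n \<in> ?V) \<and>
      (\<forall>e>0. \<exists>N::nat. \<forall>m\<ge>N. \<forall>n\<ge>N. B (\<lambda>x. \<phi> m x - \<phi> n x) (\<lambda>x. \<phi> m x - \<phi> n x) < e) \<and>
      (\<forall>\<psi>\<in>?V. (\<lambda>n. B (\<phi> n) \<psi>) \<longlonglongrightarrow> F \<psi>)"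
    by (rule riesz_sequence; (rule zero_test_function B_sym C0 | erule (2) B_add | erule (1) B_scale |
          erule (1) test_functions_add | erule test_functions_scale B_nonneg F_bound |
          blast intro: F_add F_scale test_function_H10))
  then obtain \<phi> where \<phi>: "\<And>n. \<phi> n \<in> ?V"
      "\<forall>e>0. \<exists>N::nat. \<forall>m\<ge>N. \<forall>n\<ge>N. B (\<lambda>x. \<phi> m x - \<phi> n x) (\<lambda>x. \<phi> m x - \<phi> n x) < e"
      "\<forall>\<psi>\<in>?V. (\<lambda>n. B (\<phi> n) \<psi>) \<longlonglongrightarrow> F \<psi>"
    by blast
  have diff: "(\<lambda>x. \<phi> m x - \<phi> n x) \<in> ?V" for m n using \<phi>(1) by (intro test_functions_diff)
  have grad_Cauchy: "\<exists>N. \<forall>m\<ge>N. \<forall>n\<ge>N. (LINT x|L. (norm (grad (\<phi> m) x - grad (\<phi> n) x))\<^sup>2) < e" if "0 < e" for e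
  proof -
    obtain N where N: "\<forall>m\<ge>N. \<forall>n\<ge>N. B (\<lambda>x. \<phi> m x - \<phi> n x) (\<lambda>x. \<phi> m x - \<phi> n x) < c1 * e"
      using \<phi>(2)[rule_format, of "c1 * e"] a(3) \<open>0 < e\<close> by auto
    have "(LINT x|L. (norm (grad (\<phi> m) x - grad (\<phi> n) x))\<^sup>2) < e" if "N \<le> m" "N \<le> n" for m n
    proof -
      have "c1 * (LINT x|L. (norm (grad (\<phi> m) x - grad (\<phi> n) x))\<^sup>2) < c1 * e"
        using coercive[OF diff[of m n]] N that unfolding grad_diff[OF \<phi>(1) \<phi>(1)] by fastforce
      then show ?thesis using a(3) by simp
    qed
    then show ?thesis by blast
  qed
  have Cauchy: "\<exists>N. \<forall>m\<ge>N. \<forall>n\<ge>N. (LINT x|L. (norm (\<phi> m x - \<phi> n x))\<^sup>2) < e" if "0 < e" for e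
  proof -
    \<comment> \<open>P + 1 instead of P keeps the quotient meaningful when P = 0.\<close>
    obtain N where N: "\<forall>m\<ge>N. \<forall>n\<ge>N. (LINT x|L. (norm (grad (\<phi> m) x - grad (\<phi> n) x))\<^sup>2) < e / (P + 1)"
      using grad_Cauchy[of "e / (P + 1)"] P(1) \<open>0 < e\<close> by auto
    have "(LINT x|L. (norm (\<phi> m x - \<phi> n x))\<^sup>2) < e" if "N \<le> m" "N \<le> n" for m n
    proof -
      let ?G = "LINT x|L. (norm (grad (\<phi> m) x - grad (\<phi> n) x))\<^sup>2"
      have "(LINT x|L. (norm (\<phi> m x - \<phi> n x))\<^sup>2) \<le> P * ?G"
        using P(2)[OF diff[of m n]] unfolding grad_diff[OF \<phi>(1) \<phi>(1)] .
      also have "\<dots> \<le> (P + 1) * ?G" by (intro mult_right_mono) auto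
      also have "\<dots> < (P + 1) * (e / (P + 1))" using N that P(1) by (intro mult_strict_left_mono) auto
      also have "\<dots> = e" using P(1) by simp
      finally show ?thesis .
    qed
    then show ?thesis by blast
  qed
  obtain u where u: "L2_lim L \<phi> u"
    using L2_complete[OF sq(1)[OF \<phi>(1)] Cauchy] sq(1)[OF \<phi>(1)] by (auto simp: L2_lim_def)
  obtain g where g: "L2_lim L (\<lambda>n. grad (\<phi> n)) g"
    using L2_complete[OF sq(2)[OF \<phi>(1)] grad_Cauchy] sq(2)[OF \<phi>(1)] by (auto simp: L2_lim_def)
  have uH: "u \<in> H10 \<Omega>" unfolding H10_iff using \<phi>(1) u g by blast
  have sqw: "square_integrable L (wgrad \<Omega> v)" if "v \<in> H10 \<Omega>" for v
    using that H1_wgrad(2) by (simp add: H10_def)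
  have gw: "AE x in L. wgrad \<Omega> u x = g x"
    using u g is_weak_grad_lim[OF u g is_weak_grad_grad[OF \<phi>(1)]]
    by (intro wgrad_AE_eq) (auto simp: L2_lim_def)
  have test: "(LINT x|L. grad \<psi> x \<bullet> (a x *\<^sub>R wgrad \<Omega> u x)) = F \<psi>" if \<psi>: "\<psi> \<in> ?V" for \<psi>
  proof -
    have "(\<lambda>n. B (\<phi> n) \<psi>) \<longlonglongrightarrow> (LINT x|L. g x \<bullet> (a x *\<^sub>R grad \<psi> x))"
      unfolding B_def by (rule L2_lim_inner[OF g asq[OF sq(2)[OF \<psi>]]])
    then have "(LINT x|L. g x \<bullet> (a x *\<^sub>R grad \<psi> x)) = F \<psi>"
      using \<phi>(3)[rule_format, OF \<psi>] LIMSEQ_unique by blast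
    moreover have "(LINT x|L. grad \<psi> x \<bullet> (a x *\<^sub>R wgrad \<Omega> u x)) = (LINT x|L. g x \<bullet> (a x *\<^sub>R grad \<psi> x))"
    proof (rule integral_cong_AE)
      show "AE x in L. grad \<psi> x \<bullet> (a x *\<^sub>R wgrad \<Omega> u x) = g x \<bullet> (a x *\<^sub>R grad \<psi> x)"
        using gw by eventually_elim (simp add: inner_commute)
      show "(\<lambda>x. grad \<psi> x \<bullet> (a x *\<^sub>R wgrad \<Omega> u x)) \<in> borel_measurable L"
        using square_integrable_inner[OF sq(2)[OF \<psi>] asq[OF sqw[OF uH]]] by auto
      show "(\<lambda>x. g x \<bullet> (a x *\<^sub>R grad \<psi> x)) \<in> borel_measurable L"
        using square_integrable_inner[OF _ asq[OF sq(2)[OF \<psi>]], of g] g by (auto simp: L2_lim_def)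
    qed
    ultimately show ?thesis by simp
  qed
  \<comment> \<open>Density: along test functions converging to \<open>v\<close> in H1, the left
    side converges by \<open>L2_lim_inner\<close> and the right side by boundedness of
    \<open>F\<close>.\<close>
  have "(LINT x|L. (a x *\<^sub>R wgrad \<Omega> u x) \<bullet> wgrad \<Omega> v x) = F v" if v: "v \<in> H10 \<Omega>" for v
  proof -
    obtain \<psi> where \<psi>: "\<And>n::nat. \<psi> n \<in> ?V" "(\<lambda>n. H1_norm \<Omega> (\<lambda>x. \<psi> n x - v x)) \<longlonglongrightarrow> 0"
      using v by (auto simp: H10_def)
    have v1: "v \<in> H1 \<Omega>" using v by (simp add: H10_def)
    have "L2_lim L (\<lambda>n. grad (\<psi> n)) (wgrad \<Omega> v)"
      using H1_norm_diff_tendsto_0_iff[OF sq[OF \<psi>(1)] is_weak_grad_grad[OF \<psi>(1)] H1_wgrad[OF v1]] \<psi>(2)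
      by simp
    from L2_lim_inner[OF this asq[OF sqw[OF uH]]]
    have "(\<lambda>n. F (\<psi> n)) \<longlonglongrightarrow> (LINT x|L. wgrad \<Omega> v x \<bullet> (a x *\<^sub>R wgrad \<Omega> u x))"
      by (simp only: test[OF \<psi>(1)])
    moreover have "(\<lambda>n. F (\<psi> n)) \<longlonglongrightarrow> F v"
    proof -
      have "\<bar>F (\<psi> n) - F v\<bar> \<le> C * H1_norm \<Omega> (\<lambda>x. \<psi> n x - v x)" for n
      proof -
        have mv: "(\<lambda>x. (-1) * v x) \<in> H10 \<Omega>" using v by (rule H10_scale)
        have "F (\<lambda>x. \<psi> n x + (-1) * v x) = F (\<psi> n) + (-1) * F v"
          using F_add[OF test_function_H10[OF \<psi>(1)] mv] F_scale[OF v, of "-1"] by metis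
        moreover have "(\<lambda>x. \<psi> n x + (-1) * v x) \<in> H10 \<Omega>"
          using H10_add[OF test_function_H10[OF \<psi>(1)] mv] .
        ultimately show ?thesis using C[rule_format, of "\<lambda>x. \<psi> n x - v x"] by simp
      qed
      then have "(\<lambda>n. F (\<psi> n) - F v) \<longlonglongrightarrow> 0"
        by (intro Lim_null_comparison[OF _ tendsto_mult_right_zero[OF \<psi>(2), of C]] always_eventually) simp
      then show ?thesis by (simp add: LIM_zero_iff)
    qed
    ultimately have "(LINT x|L. wgrad \<Omega> v x \<bullet> (a x *\<^sub>R wgrad \<Omega> u x)) = F v"
      by (rule LIMSEQ_unique)
    then show ?thesis by (simp add: inner_commute)
  qed
  then have "weak_solution \<Omega> a F u" using uH by (simp add: weak_solution_def neg_div_eq_def)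
  then show ?thesis by blast
qed

end

section \<open>The materials and the energy identity\<close>

text \<open>\<open>LEAST\<close> is informative only once a least eigenvalue is known to exist. It
  is the minimum of the quadratic form over the unit sphere, attained by compactness and positive by
  definiteness.\<close>

lemma sym_pos_def_lambda1_pos:
  fixes A :: "real^'d^'d::finite"
  assumes "sym_pos_def A"
  shows "0 < lambda1 A"
proof -
  have pos: "v \<noteq> 0 \<Longrightarrow> 0 < v \<bullet> (A *v v)" and sym: "x \<bullet> (A *v y) = y \<bullet> (A *v x)" for v x y
    using assms dot_lmul_matrix[of x A y] transpose_matrix_vector[of A x]
    by (auto simp: sym_pos_def_def inner_commute)
  let ?q = "\<lambda>v. v \<bullet> (A *v v)"
  have "sphere (0::real^'d) 1 \<noteq> {}" by simp
  moreover have "continuous_on (sphere 0 1) ?q"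
    by (intro continuous_on_inner continuous_on_id linear_continuous_on matrix_vector_mul_bounded_linear)
  ultimately obtain v0 where "v0 \<in> sphere 0 1" "\<forall>v\<in>sphere 0 1. ?q v0 \<le> ?q v"
    using continuous_attains_inf[OF compact_sphere] by blast
  then have v0: "norm v0 = 1" "\<And>v. norm v = 1 \<Longrightarrow> ?q v0 \<le> ?q v"
    by auto
  define l where "l = ?q v0"
  have "v0 \<noteq> 0" using v0(1) by force
  then have l_pos: "0 < l" unfolding l_def by (rule pos)
  have rayleigh: "l * (w \<bullet> w) \<le> ?q w" for w
  proof (cases "w = 0")
    case False
    have "l \<le> ?q (w /\<^sub>R norm w)" unfolding l_def using False by (intro v0(2)) simp
    also have "\<dots> = ?q w / (w \<bullet> w)"
      by (simp add: matrix_vector_mult_scaleR power2_eq_square field_simps flip: power2_norm_eq_inner)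
    finally show ?thesis using False by (simp add: field_simps)
  qed simp
  have "A *v v0 = l *\<^sub>R v0"
  proof -
    \<comment> \<open>Perturbing the minimiser in the direction of its residual \<open>z\<close>
      makes the Rayleigh inequality a nonnegative quadratic in \<open>t\<close> with zero constant
      term; its linear coefficient, the squared length of \<open>z\<close>, must vanish.\<close>
    define z where "z = A *v v0 - l *\<^sub>R v0"
    have "(z \<bullet> z)\<^sup>2 \<le> 0 * (?q z - l * (z \<bullet> z))"
    proof (rule quadratic_nonneg_imp_discriminant_le)
      fix t
      have v00: "v0 \<bullet> v0 = 1" using v0(1) by (simp flip: power2_norm_eq_inner)
      have q: "?q (v0 + t *\<^sub>R z) = l + 2 * t * (z \<bullet> (A *v v0)) + t\<^sup>2 * ?q z"
        using sym[of v0 z]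
        by (simp add: matrix_vector_right_distrib matrix_vector_mult_scaleR inner_add_left
            inner_add_right l_def power2_eq_square algebra_simps)
      have n: "l * ((v0 + t *\<^sub>R z) \<bullet> (v0 + t *\<^sub>R z)) = l + 2 * t * (z \<bullet> (l *\<^sub>R v0)) + t\<^sup>2 * (l * (z \<bullet> z))"
        using v00 by (simp add: inner_add_left inner_add_right inner_commute power2_eq_square algebra_simps)
      have "z \<bullet> z = z \<bullet> (A *v v0) - z \<bullet> (l *\<^sub>R v0)"
        unfolding z_def by (rule inner_diff_right)
      then have "2 * t * (z \<bullet> z) = 2 * t * (z \<bullet> (A *v v0)) - 2 * t * (z \<bullet> (l *\<^sub>R v0))"
        by (simp only: right_diff_distrib)
      then show "0 \<le> 0 + 2 * t * (z \<bullet> z) + t\<^sup>2 * (?q z - l * (z \<bullet> z))"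
        using rayleigh[of "v0 + t *\<^sub>R z"] unfolding q n right_diff_distrib by linarith
      show "0 \<le> ?q z - l * (z \<bullet> z)" using rayleigh[of z] by simp
    qed
    then show ?thesis by (simp add: z_def)
  qed
  then have "is_eigenvalue A l" using \<open>v0 \<noteq> 0\<close> by (auto simp: is_eigenvalue_def)
  moreover have "l \<le> l'" if "is_eigenvalue A l'" for l'
  proof -
    obtain v where "v \<noteq> 0" "A *v v = l' *\<^sub>R v" using \<open>is_eigenvalue A l'\<close> by (auto simp: is_eigenvalue_def)
    then show ?thesis using rayleigh[of v] by simp
  qed
  ultimately have "lambda1 A = l" unfolding lambda1_def by (rule Least_equality)
  then show ?thesis using l_pos by simp
qed

text \<open>\<open>lambda_minus\<close> is a weighted harmonic mean of the smallest eigenvalues,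
  hence between their minimum and maximum. This gives ellipticity bounds uniform over all
  designs.\<close>

lemma lambda_minus_bounds:
  assumes "\<And>k. sym_pos_def (M k)"
  shows "\<exists>c1 c2. 0 < c1 \<and> (\<forall>t\<in>K. c1 \<le> lambda_minus M t \<and> lambda_minus M t \<le> c2)"
proof (intro exI conjI ballI)
  let ?l = "\<lambda>k. lambda1 (M k)"
  let ?c1 = "Min (range ?l)" and ?c2 = "Max (range ?l)"
  have l: "0 < ?l k" for k using sym_pos_def_lambda1_pos[OF assms] .
  show c1: "0 < ?c1" using l by simp
  have c2: "0 < ?c2" using l by (subst Max_gr_iff) auto
  fix t :: "real^'a" assume t: "t \<in> K"
  let ?s = "\<Sum>k\<in>UNIV. t $ k / ?l k"
  have t0: "0 \<le> t $ k" and t1: "(\<Sum>k\<in>UNIV. t $ k) = 1" for k using t by (auto simp: K_def)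
  have "?s \<le> (\<Sum>k\<in>UNIV. t $ k / ?c1)"
    using t0 l c1 by (intro sum_mono divide_left_mono) auto
  then have s1: "?s \<le> 1 / ?c1" by (simp add: t1 flip: sum_divide_distrib)
  have "(\<Sum>k\<in>UNIV. t $ k / ?c2) \<le> ?s"
    using t0 l c2 by (intro sum_mono divide_left_mono) auto
  then have s2: "1 / ?c2 \<le> ?s" by (simp add: t1 flip: sum_divide_distrib)
  have s: "0 < ?s" using s2 c2 by (smt (verit) divide_pos_pos)
  show "?c1 \<le> lambda_minus M t" using s1 s c1 by (simp add: lambda_minus_def field_simps)
  show "lambda_minus M t \<le> ?c2" using s2 s c2 by (simp add: lambda_minus_def field_simps)
qed

context bounded_domain
begin

text \<open>Since the weight 1/a cancels the factor a in \<open>\<tau>\<close>, both the cross term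
  and the square of \<open>\<tau>\<close> become pairings with \<open>wgrad \<Omega> u\<close>, and
  each equals \<open>F u\<close>. Integrability of the remainder is recorded too: only then does a
  zero integral force the integrand to vanish almost everywhere.\<close>

lemma energy_identity:
  assumes a: "a \<in> borel_measurable L" "AE x in L. c1 \<le> a x \<and> a x \<le> c2" "0 < c1"
    and u: "weak_solution \<Omega> a F u"
    and \<sigma>: "square_integrable L \<sigma>" "neg_div_eq \<Omega> \<sigma> F"
  defines "\<tau> \<equiv> \<lambda>x. a x *\<^sub>R wgrad \<Omega> u x"
  shows "square_integrable L \<tau>"
    and "integrable L (\<lambda>x. (norm (\<sigma> x - \<tau> x))\<^sup>2 / a x)"
    and "(LINT x|L. (norm (\<sigma> x))\<^sup>2 / a x) = F u + (LINT x|L. (norm (\<sigma> x - \<tau> x))\<^sup>2 / a x)"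
proof -
  have uH: "u \<in> H10 \<Omega>" using u by (simp add: weak_solution_def)
  have g: "square_integrable L (wgrad \<Omega> u)" using uH H1_wgrad(2) by (simp add: H10_def)
  have "AE x in L. \<bar>a x\<bar> \<le> c2" using a(2,3) by auto
  with g a(1) show \<tau>: "square_integrable L \<tau>"
    unfolding \<tau>_def by (rule square_integrable_bounded_scale)
  have inv_bound: "AE x in L. \<bar>1 / a x\<bar> \<le> 1 / c1"
    using a(2)
  proof eventually_elim
    case (elim x)
    then show ?case using a(3) by (simp add: divide_le_cancel frac_le)
  qed
  have quot: "integrable L (\<lambda>x. (norm (f x))\<^sup>2 / a x)" if f: "square_integrable L f" for f :: "real^'d \<Rightarrow> real^'d"
  proof -
    have "square_integrable L (\<lambda>x. (1 / a x) *\<^sub>R f x)"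
      using f _ inv_bound by (rule square_integrable_bounded_scale) (use a(1) in measurable)
    from square_integrable_inner[OF f this] show ?thesis
      by (simp add: power2_norm_eq_inner)
  qed
  show d: "integrable L (\<lambda>x. (norm (\<sigma> x - \<tau> x))\<^sup>2 / a x)"
    by (intro quot square_integrable_diff \<sigma>(1) \<tau>)
  have "(LINT x|L. (norm (\<sigma> x))\<^sup>2 / a x) =
      (LINT x|L. (norm (\<sigma> x - \<tau> x))\<^sup>2 / a x + 2 * (\<sigma> x \<bullet> wgrad \<Omega> u x) - \<tau> x \<bullet> wgrad \<Omega> u x)"
  proof (rule integral_cong_AE)
    show "AE x in L. (norm (\<sigma> x))\<^sup>2 / a x =
        (norm (\<sigma> x - \<tau> x))\<^sup>2 / a x + 2 * (\<sigma> x \<bullet> wgrad \<Omega> u x) - \<tau> x \<bullet> wgrad \<Omega> u x"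
      using a(2)
    proof eventually_elim
      case (elim x)
      then have "a x \<noteq> 0" using a(3) by auto
      then show ?case
        unfolding power2_norm_eq_inner \<tau>_def
        by (simp add: inner_diff_left inner_diff_right inner_commute field_simps)
    qed
  qed (use quot[OF \<sigma>(1)] d square_integrable_inner[OF \<sigma>(1) g] square_integrable_inner[OF \<tau> g] in auto)
  also have "\<dots> = (LINT x|L. (norm (\<sigma> x - \<tau> x))\<^sup>2 / a x) + 2 * F u - F u"
    using d square_integrable_inner[OF \<sigma>(1) g] square_integrable_inner[OF \<tau> g] \<sigma>(2) u uH
    by (simp add: weak_solution_def neg_div_eq_def \<tau>_def)
  finally show "(LINT x|L. (norm (\<sigma> x))\<^sup>2 / a x) = F u + (LINT x|L. (norm (\<sigma> x - \<tau> x))\<^sup>2 / a x)"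
    by simp
qed

end

section \<open>Comparison of I and H for the design problem\<close>

locale design_problem = bounded_domain \<Omega>
  for \<Omega> :: "(real^'d::finite) set" +
  fixes M :: "'n::finite \<Rightarrow> real^'d^'d"
    and q :: "'n \<Rightarrow> real"
    and f :: "'m::finite \<Rightarrow> (real^'d \<Rightarrow> real) \<Rightarrow> real"
    and \<mu> :: "'m \<Rightarrow> real"
  assumes spd: "\<And>k. sym_pos_def (M k)"
    and f: "\<And>i. f i \<in> H_minus1 \<Omega>"
    and \<mu>: "\<And>i. 0 < \<mu> i"
begin

definition state_flux :: "(real^'d \<Rightarrow> real^'n) \<Rightarrow> 'm \<Rightarrow> real^'d \<Rightarrow> real^'d" where
  "state_flux \<theta> i x = lambda_minus M (\<theta> x) *\<^sub>R wgrad \<Omega> (state \<Omega> M (f i) \<theta>) x"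

lemma coefficient:
  assumes "\<theta> \<in> admissible \<Omega> q"
  obtains c1 c2 where "0 < c1" "(\<lambda>x. lambda_minus M (\<theta> x)) \<in> borel_measurable L"
    "AE x in L. c1 \<le> lambda_minus M (\<theta> x) \<and> lambda_minus M (\<theta> x) \<le> c2"
proof -
  obtain c1 c2 where c: "0 < c1" "\<forall>t\<in>K. c1 \<le> lambda_minus M t \<and> lambda_minus M t \<le> c2"
    using lambda_minus_bounds[of M, OF spd] by blast
  have \<theta>: "\<theta> \<in> borel_measurable L" "AE x in L. \<theta> x \<in> K"
    using assms by (auto simp: admissible_def)
  have [measurable]: "(\<lambda>x. \<theta> x $ k) \<in> borel_measurable L" for k
    using borel_measurable_inner[OF \<theta>(1), of "\<lambda>_. axis k 1"] by (simp add: inner_axis)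
  have "(\<lambda>x. lambda_minus M (\<theta> x)) \<in> borel_measurable L"
    unfolding lambda_minus_def by measurable
  moreover have "AE x in L. c1 \<le> lambda_minus M (\<theta> x) \<and> lambda_minus M (\<theta> x) \<le> c2"
    using \<theta>(2) c(2) by auto
  ultimately show thesis using that c(1) by blast
qed

text \<open>Existence is what turns the Hilbert choice in \<open>state\<close> into an actual
  solution.\<close>

lemma state_weak_solution:
  assumes "\<theta> \<in> admissible \<Omega> q"
  shows "weak_solution \<Omega> (\<lambda>x. lambda_minus M (\<theta> x)) (f i) (state \<Omega> M (f i) \<theta>)"
proof -
  obtain c1 c2 where "0 < c1" "(\<lambda>x. lambda_minus M (\<theta> x)) \<in> borel_measurable L"
    "AE x in L. c1 \<le> lambda_minus M (\<theta> x) \<and> lambda_minus M (\<theta> x) \<le> c2"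
    using coefficient[OF assms] .
  from weak_solution_exists[OF this(2,3,1) f] show ?thesis
    unfolding state_def by (rule someI_ex)
qed

text \<open>Makes the state fluxes legitimate competitors in the minimisation half of the
  saddle-point inequality.\<close>

lemma state_flux_in_fluxes:
  assumes "\<theta> \<in> admissible \<Omega> q"
  shows "state_flux \<theta> \<in> fluxes \<Omega> f"
proof -
  obtain c1 c2 where c: "0 < c1" "(\<lambda>x. lambda_minus M (\<theta> x)) \<in> borel_measurable L"
    "AE x in L. c1 \<le> lambda_minus M (\<theta> x) \<and> lambda_minus M (\<theta> x) \<le> c2"
    using coefficient[OF assms] .
  have "square_integrable L (wgrad \<Omega> (state \<Omega> M (f i) \<theta>))" for i
    using state_weak_solution[OF assms, of i] H1_wgrad(2) by (simp add: weak_solution_def H10_def)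
  moreover have "AE x in L. \<bar>lambda_minus M (\<theta> x)\<bar> \<le> c2" using c(1,3) by auto
  ultimately have "square_integrable L (state_flux \<theta> i)" for i
    unfolding state_flux_def[abs_def] using c(2) by (intro square_integrable_bounded_scale)
  then show ?thesis
    using state_weak_solution[OF assms]
    by (simp add: fluxes_def L2_iff weak_solution_def state_flux_def[abs_def])
qed

text \<open>The excess of H over I caused by a single load; the weight is left out so that the
  vanishing of each term can be read off separately.\<close>

definition defect :: "(real^'d \<Rightarrow> real^'n) \<Rightarrow> ('m \<Rightarrow> real^'d \<Rightarrow> real^'d) \<Rightarrow> 'm \<Rightarrow> real" where
  "defect \<theta> \<sigma> i = (LINT x|L. (norm (\<sigma> i x - state_flux \<theta> i x))\<^sup>2 / lambda_minus M (\<theta> x))"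

lemma
  assumes \<theta>: "\<theta> \<in> admissible \<Omega> q" and \<sigma>: "\<sigma> \<in> fluxes \<Omega> f"
  shows H_fun_eq: "H_fun \<Omega> M \<mu> \<theta> \<sigma> = I_fun \<Omega> M f \<mu> \<theta> + (\<Sum>i\<in>UNIV. \<mu> i * defect \<theta> \<sigma> i)"
    and defect_nonneg: "0 \<le> defect \<theta> \<sigma> i"
    and defect_eq_0_iff: "defect \<theta> \<sigma> i = 0 \<longleftrightarrow> (AE x in L. \<sigma> i x = state_flux \<theta> i x)"
proof -
  obtain c1 c2 where c: "0 < c1" "(\<lambda>x. lambda_minus M (\<theta> x)) \<in> borel_measurable L"
    "AE x in L. c1 \<le> lambda_minus M (\<theta> x) \<and> lambda_minus M (\<theta> x) \<le> c2"
    using coefficient[OF \<theta>] .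
  have \<sigma>': "square_integrable L (\<sigma> i)" "neg_div_eq \<Omega> (\<sigma> i) (f i)" for i
    using \<sigma> by (auto simp: fluxes_def L2_iff)
  note e = energy_identity[OF c(2,3,1) state_weak_solution[OF \<theta>] \<sigma>', folded state_flux_def]
  show "H_fun \<Omega> M \<mu> \<theta> \<sigma> = I_fun \<Omega> M f \<mu> \<theta> + (\<Sum>i\<in>UNIV. \<mu> i * defect \<theta> \<sigma> i)"
    by (simp add: H_fun_def I_fun_def e(3) defect_def distrib_left sum.distrib)
  have nonneg: "AE x in L. 0 \<le> (norm (\<sigma> i x - state_flux \<theta> i x))\<^sup>2 / lambda_minus M (\<theta> x)"
    using c(3) by eventually_elim (use c(1) in simp)
  then show "0 \<le> defect \<theta> \<sigma> i"
    unfolding defect_def by (rule integral_nonneg_AE)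
  have "defect \<theta> \<sigma> i = 0 \<longleftrightarrow> (AE x in L. (norm (\<sigma> i x - state_flux \<theta> i x))\<^sup>2 / lambda_minus M (\<theta> x) = 0)"
    unfolding defect_def by (rule integral_nonneg_eq_0_iff_AE[OF e(2) nonneg])
  also have "\<dots> \<longleftrightarrow> (AE x in L. \<sigma> i x = state_flux \<theta> i x)"
  proof
    assume "AE x in L. (norm (\<sigma> i x - state_flux \<theta> i x))\<^sup>2 / lambda_minus M (\<theta> x) = 0"
    with c(3) show "AE x in L. \<sigma> i x = state_flux \<theta> i x"
      by eventually_elim (use c(1) in auto)
  next
    assume "AE x in L. \<sigma> i x = state_flux \<theta> i x"
    then show "AE x in L. (norm (\<sigma> i x - state_flux \<theta> i x))\<^sup>2 / lambda_minus M (\<theta> x) = 0"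
      by eventually_elim simp
  qed
  finally show "defect \<theta> \<sigma> i = 0 \<longleftrightarrow> (AE x in L. \<sigma> i x = state_flux \<theta> i x)" .
qed

lemma I_fun_le_H_fun:
  assumes "\<theta> \<in> admissible \<Omega> q" "\<sigma> \<in> fluxes \<Omega> f"
  shows "I_fun \<Omega> M f \<mu> \<theta> \<le> H_fun \<Omega> M \<mu> \<theta> \<sigma>"
  using H_fun_eq[OF assms] defect_nonneg[OF assms] \<mu>
  by (simp add: sum_nonneg less_imp_le)

text \<open>The excess is a sum of nonnegative defects with positive weights, so it vanishes only if
  every single defect does.\<close>

lemma I_fun_eq_H_fun_iff:
  assumes "\<theta> \<in> admissible \<Omega> q" "\<sigma> \<in> fluxes \<Omega> f"
  shows "I_fun \<Omega> M f \<mu> \<theta> = H_fun \<Omega> M \<mu> \<theta> \<sigma> \<longleftrightarrow> (\<forall>i. AE x in L. \<sigma> i x = state_flux \<theta> i x)"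
proof -
  have "(\<Sum>i\<in>UNIV. \<mu> i * defect \<theta> \<sigma> i) = 0 \<longleftrightarrow> (\<forall>i. \<mu> i * defect \<theta> \<sigma> i = 0)"
    using defect_nonneg[OF assms] \<mu> by (subst sum_nonneg_eq_0_iff) (auto simp: less_imp_le)
  also have "\<dots> \<longleftrightarrow> (\<forall>i. defect \<theta> \<sigma> i = 0)"
    using \<mu> by (metis less_irrefl mult_eq_0_iff)
  finally show ?thesis using H_fun_eq[OF assms] defect_eq_0_iff[OF assms] by simp
qed

end

theorem mainTheorem2:
  fixes \<Omega> :: "(real^'d) set"
    and M :: "'n::finite \<Rightarrow> real^'d^'d"
    and q :: "'n \<Rightarrow> real"
    and f :: "'m::finite \<Rightarrow> (real^'d \<Rightarrow> real) \<Rightarrow> real"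
    and \<mu> :: "'m \<Rightarrow> real"
    and \<sigma>s :: "'m \<Rightarrow> real^'d \<Rightarrow> real^'d"
    and \<theta>s :: "real^'d \<Rightarrow> real^'n"
  assumes "open \<Omega>" and "bounded \<Omega>"
    and "\<And>k. sym_pos_def (M k)"
    and "\<And>k. q k \<ge> 0"
    and "(\<Sum>k\<in>UNIV. q k) = measure lebesgue \<Omega>"
    and "\<And>i. f i \<in> H_minus1 \<Omega>"
    and "\<And>i. \<mu> i > 0"
    and "optimal_flux \<Omega> M q f \<mu> \<sigma>s"
    and "\<theta>s \<in> admissible \<Omega> q"
  shows "is_arg_max (I_fun \<Omega> M f \<mu>) (\<lambda>\<theta>. \<theta> \<in> admissible \<Omega> q) \<theta>s \<longleftrightarrow>
     is_arg_max (\<lambda>\<theta>. H_fun \<Omega> M \<mu> \<theta> \<sigma>s) (\<lambda>\<theta>. \<theta> \<in> admissible \<Omega> q) \<theta>s \<and>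
     (\<forall>i. AE x in lebesgue_on \<Omega>.
        \<sigma>s i x = lambda_minus M (\<theta>s x) *\<^sub>R wgrad \<Omega> (state \<Omega> M (f i) \<theta>s) x)"
proof -
  interpret design_problem \<Omega> M q f \<mu>
    using assms by unfold_locales
  let ?I = "I_fun \<Omega> M f \<mu>" and ?H = "\<lambda>\<theta>. H_fun \<Omega> M \<mu> \<theta> \<sigma>s" and ?T = "admissible \<Omega> q"
  obtain \<theta>0 where saddle: "saddle_point \<Omega> M q f \<mu> \<theta>0 \<sigma>s"
    using assms(8) by (auto simp: optimal_flux_def)
  then have \<theta>0: "\<theta>0 \<in> ?T" and \<sigma>s: "\<sigma>s \<in> fluxes \<Omega> f"
    and H_le: "\<And>\<theta>. \<theta> \<in> ?T \<Longrightarrow> ?H \<theta> \<le> ?H \<theta>0"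
    and le_H: "\<And>\<sigma>. \<sigma> \<in> fluxes \<Omega> f \<Longrightarrow> ?H \<theta>0 \<le> H_fun \<Omega> M \<mu> \<theta>0 \<sigma>"
    by (auto simp: saddle_point_def)
  \<comment> \<open>The state flux has zero defect against itself.\<close>
  have "?I \<theta>0 = H_fun \<Omega> M \<mu> \<theta>0 (state_flux \<theta>0)"
    using I_fun_eq_H_fun_iff[OF \<theta>0 state_flux_in_fluxes[OF \<theta>0]] by simp
  \<comment> \<open>Sandwich: \<open>\<sigma>s\<close> minimises H at \<open>\<theta>0\<close>, so
    its value there is at most that of the state flux, which is I, while I is a lower bound for
    every flux.\<close>
  then have I_eq: "?I \<theta>0 = ?H \<theta>0"
    using le_H[OF state_flux_in_fluxes[OF \<theta>0]] I_fun_le_H_fun[OF \<theta>0 \<sigma>s] by linarith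
  have arg_max: "is_arg_max g (\<lambda>\<theta>. \<theta> \<in> ?T) \<theta>s \<longleftrightarrow> (\<forall>\<theta>\<in>?T. g \<theta> \<le> g \<theta>s)" for g :: "_ \<Rightarrow> real"
    using assms(9) by (auto simp: is_arg_max_linorder)
  \<comment> \<open>A pure order argument: \<open>?I\<close> lies below \<open>?H\<close> and
    touches it at the maximiser \<open>\<theta>0\<close> of \<open>?H\<close>, so both have the same
    maximum. A maximiser of \<open>?I\<close> is then squeezed up to \<open>?H\<close>; conversely,
    contact at a maximiser of \<open>?H\<close> gives the maximal value of
    \<open>?I\<close>.\<close>
  have "(\<forall>\<theta>\<in>?T. ?I \<theta> \<le> ?I \<theta>s) \<longleftrightarrow> (\<forall>\<theta>\<in>?T. ?H \<theta> \<le> ?H \<theta>s) \<and> ?I \<theta>s = ?H \<theta>s"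
    using I_fun_le_H_fun[OF _ \<sigma>s] H_le I_eq \<theta>0 assms(9) by (smt (verit))
  then show ?thesis
    unfolding arg_max I_fun_eq_H_fun_iff[OF assms(9) \<sigma>s] state_flux_def .
qed

end
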